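(* Let $d > 0$ be real, let $P = \{(x,y) \in \mathbb{R}^2 : |x|, |y| \le d \text{ and } (x = 0 \text{ or } y = 0)\}$, and let $c > 0$. For integers $t \ge 2$ let $Q_{P,t,c} = \{(x, y, z) : (x,y) \in P,\ z \in \{c, 2c, \dots, tc\}\} \subseteq \mathbb{R}^3$. Then $\operatorname{opx}(n, Q_{P,2,c}, 3) = \Theta(n^{\frac52})$ and $\operatorname{opx}(n, Q_{P,3,c}, 3) = \Theta(n^{\frac83})$ as $n \to \infty$.
   Context: Containment for subsets of $\mathbb{R}^3$: for $P, S \subseteq \mathbb{R}^3$, let $C_i(P)$ and $C_i(S)$ be the sets of all $i$-th coordinates of points of $P$ and $S$. $S$ contains $P$ if there exist functions $f_i : C_i(P) \to C_i(S)$ for $i = 1, 2, 3$ such that (1) for each $i$, $\frac{f_i(x)-f_i(x')}{x-x'} \ge 1$ for all $x > x'$ in $C_i(P)$; (2) $(f_1(x_1), f_2(x_2), f_3(x_3)) \in S$ for all $(x_1, x_2, x_3) \in P$. Otherwise $S$ is $P$-free. For real $n > 0$, $\operatorname{opx}(n,P,3)$ is the supremum of the Lebesgue measure $\mu_3(S)$ over all open (in $\mathbb{R}^3$) $P$-free subsets $S \subseteq [0,n]^3$. $f(n) = \Theta(g(n))$ means there are constants $C_1, C_2 > 0$ with $C_1 g(n) \le f(n) \le C_2 g(n)$ for all sufficiently large real $n$; here the constants may depend on $c$ and $d$. *)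

theory Defs
  imports "HOL-Analysis.Analysis" "HOL-Library.Landau_Symbols"
begin

definition coords :: "'d::finite \<Rightarrow> (real ^ 'd) set \<Rightarrow> real set" where
  "coords i A = (\<lambda>v. v $ i) ` A"

text \<open>Each \<open>f i\<close> is a total function here, but only its values on \<open>coords i P\<close> are constrained.\<close>

definition contains :: "(real ^ 'd::finite) set \<Rightarrow> (real ^ 'd) set \<Rightarrow> bool" where
  "contains S P \<longleftrightarrow>
     (\<exists>f :: 'd \<Rightarrow> real \<Rightarrow> real.
        (\<forall>i. f i \<in> coords i P \<rightarrow> coords i S) \<and>
        (\<forall>i. \<forall>x \<in> coords i P. \<forall>x' \<in> coords i P.
            x > x' \<longrightarrow> (f i x - f i x') / (x - x') \<ge> 1) \<and>
        (\<forall>v \<in> P. (\<chi> i. f i (v $ i)) \<in> S))"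

definition pattern_free :: "(real ^ 'd::finite) set \<Rightarrow> (real ^ 'd) set \<Rightarrow> bool" where
  "pattern_free P S \<longleftrightarrow> \<not> contains S P"

text \<open>The dimension, the third argument of \<open>opx(n, P, d)\<close>, is carried by the type.
  For nonempty \<open>P\<close> and \<open>n > 0\<close> the real supremum is over a nonempty set (the empty
  set is \<open>P\<close>-free) that is bounded above by the volume of the cube, so it is the true supremum.\<close>

definition opx :: "real \<Rightarrow> (real ^ 'd::finite) set \<Rightarrow> real" where
  "opx n P = (SUP S \<in> {S. open S \<and> S \<subseteq> cbox 0 (\<chi> i. n) \<and> pattern_free P S}. measure lebesgue S)"

definition cross :: "real \<Rightarrow> (real ^ 2) set" where
  "cross d = {v. \<bar>v $ 1\<bar> \<le> d \<and> \<bar>v $ 2\<bar> \<le> d \<and> (v $ 1 = 0 \<or> v $ 2 = 0)}"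

definition Q :: "(real ^ 2) set \<Rightarrow> nat \<Rightarrow> real \<Rightarrow> (real ^ 3) set" where
  "Q P t c = {vector [v $ 1, v $ 2, z] | v z. v \<in> P \<and> z \<in> (\<lambda>k. real k * c) ` {1..t}}"

end

theory Submission
  imports "HOL-Library.Z2" "HOL-Algebra.Algebraic_Closure_Type" Defs
begin

text \<open>For \<open>t \<in> {2, 3}\<close> the answer is \<open>n powr (3 - 1 / t)\<close>, the Kovari-Sos-Turan exponent shifted by one.

  Upper bound: an open planar set in \<open>[0, n]\<^sup>2\<close> of area more than \<open>4 d n\<close> contains the cross, because the
  points with at most \<open>d\<close> of the set on one given side in their row (or column) have area at most \<open>d n\<close>.
  Hence any \<open>t\<close> horizontal slices of a pattern-free \<open>S\<close> at mutual distance at least \<open>c\<close> meet in area at most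
  \<open>4 d n\<close>. Taking the slices at heights \<open>(j + u) c\<close> and counting how many of them contain a given point
  of the square bounds their total area for each offset \<open>u\<close>; then one integrates over \<open>u\<close>.

  Lower bound: take a bipartite graph without \<open>K\<^sub>3\<^sub>,\<^sub>t\<close> on \<open>N + N\<close> vertices, \<open>N \<approx> n\<close>, with of the order of
  \<open>N powr (2 - 1 / t)\<close> edges (point-line incidences for \<open>t = 2\<close>, the projective norm graph for \<open>t = 3\<close>), thicken each
  edge to a \<open>d \<times> c\<close> cell in the \<open>xz\<close>-plane, and multiply by \<open>[0, n]\<close> in the \<open>y\<close>-direction. A copy of the
  pattern would put \<open>f\<^sub>1 (-d), f\<^sub>1 0, f\<^sub>1 d\<close> into three columns and the \<open>t\<close> heights into \<open>t\<close> rows of cells.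
  The finite fields are taken of order \<open>q = 2 ^ m\<close>, so that consecutive sizes differ by a bounded factor
  and no result on gaps between primes is needed.\<close>

section \<open>Bipartite graphs without small complete subgraphs\<close>

text \<open>The sides are ordered: \<open>s\<close> counts left vertices, which become columns in
  the x-direction, and \<open>t\<close> counts right vertices, which become rows in the z-direction.
  For positive \<open>s\<close> and \<open>t\<close> the cardinality conditions make
  \<open>I\<close> and \<open>J\<close> finite.\<close>

definition biclique_free :: "nat \<Rightarrow> nat \<Rightarrow> ('a \<times> 'b) set \<Rightarrow> bool" where
  "biclique_free s t E \<longleftrightarrow> (\<forall>I J. card I = s \<and> card J = t \<longrightarrow> \<not> I \<times> J \<subseteq> E)"

lemma biclique_free_mono:
  assumes "biclique_free s t E" "s \<le> s'"
  shows "biclique_free s' t E"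
  unfolding biclique_free_def
proof (intro allI impI notI)
  fix I J assume *: "card I = s' \<and> card J = t" "I \<times> J \<subseteq> E"
  then obtain I' where "I' \<subseteq> I" "card I' = s"
    using obtain_subset_with_card_n[of s I] assms(2) by auto
  moreover from this * have "I' \<times> J \<subseteq> E" by auto
  ultimately show False
    using * assms(1) unfolding biclique_free_def by auto
qed

text \<open>Relabels the vertices by natural numbers, so that edges can address the cells of a grid.
  A biclique in the image is pulled back along the inverses of the two numberings.\<close>

lemma biclique_free_transport:
  assumes E: "biclique_free s t E" "E \<subseteq> A \<times> B" and "s > 0" "t > 0"
    and fin: "finite A" "finite B" and le: "card A \<le> N" "card B \<le> N"
  obtains E' :: "(nat \<times> nat) set"
  where "biclique_free s t E'" "E' \<subseteq> {..<N} \<times> {..<N}" "card E' = card E"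
proof -
  obtain f where f: "bij_betw f A {0..<card A}"
    using ex_bij_betw_finite_nat[OF fin(1)] by blast
  obtain g where g: "bij_betw g B {0..<card B}"
    using ex_bij_betw_finite_nat[OF fin(2)] by blast
  have inj: "inj_on f A" "inj_on g B"
    by (rule bij_betw_imp_inj_on[OF f], rule bij_betw_imp_inj_on[OF g])
  have im: "f x < card A" if "x \<in> A" for x
    using bij_betwE[OF f] that by auto
  have im': "g y < card B" if "y \<in> B" for y
    using bij_betwE[OF g] that by auto
  let ?E = "map_prod f g ` E"
  have "biclique_free s t ?E"
    unfolding biclique_free_def
  proof (intro allI impI notI)
    fix I J assume *: "card I = s \<and> card J = t" "I \<times> J \<subseteq> ?E"
    with \<open>s > 0\<close> \<open>t > 0\<close> have ne: "I \<noteq> {}" "J \<noteq> {}" by auto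
    have "I \<times> J \<subseteq> f ` A \<times> g ` B"
      using *(2) image_mono[OF E(2), of "map_prod f g"] by (simp add: map_prod_surj_on)
    \<comment> \<open>Inclusion of products passes to the factors only for nonempty factors, hence
      the positivity of \<open>s\<close> and \<open>t\<close>.\<close>
    then have IA: "I \<subseteq> f ` A" and JB: "J \<subseteq> g ` B"
      using ne by (auto simp: times_subset_iff)
    define I' J' where "I' = inv_into A f ` I" and "J' = inv_into B g ` J"
    have "card I' = s" "card J' = t"
      using * inj_on_inv_into[OF IA] inj_on_inv_into[OF JB]
      by (auto simp: I'_def J'_def card_image)
    moreover have "I' \<times> J' \<subseteq> E"
    proof clarify
      fix x y assume "x \<in> I'" "y \<in> J'"
      then obtain i j where ij: "i \<in> I" "x = inv_into A f i" "j \<in> J" "y = inv_into B g j"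
        by (auto simp: I'_def J'_def)
      then obtain a b where ab: "(a, b) \<in> E" "i = f a" "j = g b"
        using * by blast
      with E(2) have "a \<in> A" "b \<in> B" by auto
      with ab ij inj show "(x, y) \<in> E" by simp
    qed
    ultimately show False
      using E(1) unfolding biclique_free_def by blast
  qed
  moreover have "?E \<subseteq> {..<N} \<times> {..<N}"
  proof -
    have "map_prod f g ` (A \<times> B) \<subseteq> {..<N} \<times> {..<N}"
      using im im' le by (auto intro: order.strict_trans2)
    with E(2) show ?thesis by blast
  qed
  moreover have "inj_on (map_prod f g) E"
    using map_prod_inj_on[OF inj] E(2) by (rule inj_on_subset)
  ultimately show thesis
    using that by (metis card_image)
qed

section \<open>The fields of order 2^m inside the algebraic closure of the field with two
  elements\<close>

text \<open>Over an algebraically closed field \<open>p\<close> splits into a multiset of linear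
  factors. A repeated factor would make its root a zero of \<open>pderiv p\<close> too, so the
  multiset is a set.\<close>

lemma card_roots_separable:
  fixes p :: "'a :: alg_closed_field poly"
  assumes "p \<noteq> 0" and sep: "\<And>x. poly p x = 0 \<Longrightarrow> poly (pderiv p) x \<noteq> 0"
  shows "card {x. poly p x = 0} = Polynomial.degree p"
proof -
  obtain A l where A: "size A = Polynomial.degree p" "p = smult l (\<Prod>x\<in>#A. [:-x, 1:])"
    using alg_closed_imp_factorization[OF assms(1)] by blast
  with \<open>p \<noteq> 0\<close> have "l \<noteq> 0" by auto
  have roots: "{x. poly p x = 0} = set_mset A"
    using \<open>l \<noteq> 0\<close> unfolding A(2) by (auto simp: poly_prod_mset)
  have le1: "count A x \<le> 1" for x
  proof (rule ccontr)
    assume "\<not> count A x \<le> 1"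
    then have "{#x, x#} \<subseteq># A"
      by (auto simp: subseteq_mset_def)
    then obtain B where "A = {#x, x#} + B"
      by (metis subset_mset.le_iff_add)
    with A(2) have "p = [:-x, 1:] * ([:-x, 1:] * smult (l) (\<Prod>x\<in>#B. [:-x, 1:]))"
      by (simp add: mult_ac)
    then obtain r where p: "p = [:-x, 1:] * ([:-x, 1:] * r)" by metis
    show False
      using sep[of x] unfolding p by (simp add: pderiv_mult del: mult_pCons_left mult_pCons_right)
  qed
  have "A = mset_set (set_mset A)"
  proof (rule multiset_eqI)
    fix x show "count A x = count (mset_set (set_mset A)) x"
      using le1[of x] count_eq_zero_iff[of A x] by (cases "x \<in># A") (auto simp: count_mset_set' le_Suc_eq)
  qed
  then show ?thesis
    using A(1) roots by (metis size_mset_set)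
qed

text \<open>One ambient field holds every field of order 2^m, in particular the field of order q
  together with its quadratic extension, so that no type has to depend on \<open>m\<close>.\<close>

type_synonym F2bar = "bit alg_closure"

lemma CHAR_F2bar: "CHAR(F2bar) = 2" and prime_CHAR_F2bar: "prime CHAR(F2bar)"
proof -
  have "CHAR(bit) = 2"
    by (rule CHAR_eq_posI) (auto simp: less_2_cases_iff)
  then show "CHAR(F2bar) = 2" "prime CHAR(F2bar)" by simp_all
qed

text \<open>The fixed points of the q-th power map. For \<open>q = 2 ^ m\<close> with
  \<open>m > 0\<close> this is the subfield with q elements; \<open>GF 1\<close> is the whole
  closure, which is why \<open>m > 0\<close> is assumed below.\<close>

definition GF :: "nat \<Rightarrow> F2bar set" where
  "GF q = {x. x ^ q = x}"

text \<open>The set consists of the roots of X^q - X. As q is even, the derivative of this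
  polynomial is the constant -1, so all q roots are simple.\<close>

lemma card_GF:
  assumes "m > 0"
  shows "card (GF (2 ^ m)) = 2 ^ m"
proof -
  define q :: nat where "q = 2 ^ m"
  have q: "q > 1" "even q"
    using assms one_less_power[of "2 :: nat" m] by (auto simp: q_def simp del: one_less_power)
  define p :: "F2bar poly" where "p = monom 1 q - monom 1 1"
  have "coeff p q = 1"
    using q by (simp add: p_def)
  then have "p \<noteq> 0" by auto
  have deg: "Polynomial.degree p = q"
    using q unfolding p_def
    by (subst diff_conv_add_uminus, subst degree_add_eq_left) (auto simp: degree_monom_eq)
  have "of_nat q = (0 :: F2bar)"
    using q by (subst of_nat_eq_0_iff_char_dvd) (simp only: CHAR_F2bar)
  then have "pderiv p = -1"
    unfolding p_def by (simp add: pderiv_diff pderiv_monom monom_0 one_pCons)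
  then have "card {x. poly p x = 0} = Polynomial.degree p"
    by (intro card_roots_separable[OF \<open>p \<noteq> 0\<close>]) simp
  moreover have "{x. poly p x = 0} = GF q"
    by (auto simp: p_def GF_def poly_monom)
  ultimately show ?thesis
    using deg q_def by simp
qed

lemma finite_GF: "m > 0 \<Longrightarrow> finite (GF (2 ^ m))"
  using card_GF[of m] by (metis card.infinite power_eq_0_iff zero_neq_numeral)

lemma power_q_add:
  fixes x y :: F2bar
  shows "(x + y) ^ (2 ^ m) = x ^ (2 ^ m) + y ^ (2 ^ m)"
  using freshmans_dream'[where ?'a = F2bar, of "2 ^ m" m x y] prime_CHAR_F2bar CHAR_F2bar by simp

lemma power_q_uminus:
  fixes x :: F2bar
  shows "m > 0 \<Longrightarrow> (- x) ^ (2 ^ m) = - (x ^ (2 ^ m))"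
  using power_q_add[of x "-x" m] by (simp add: power_0_left add_eq_0_iff)

lemma power_q_diff:
  fixes x y :: F2bar
  shows "m > 0 \<Longrightarrow> (x - y) ^ (2 ^ m) = x ^ (2 ^ m) - y ^ (2 ^ m)"
  using power_q_add[of x "-y" m] power_q_uminus[of m y] by simp

lemma GF_add: "x \<in> GF (2 ^ m) \<Longrightarrow> y \<in> GF (2 ^ m) \<Longrightarrow> x + y \<in> GF (2 ^ m)"
  by (simp add: GF_def power_q_add)

lemma GF_mult: "x \<in> GF q \<Longrightarrow> y \<in> GF q \<Longrightarrow> x * y \<in> GF q"
  by (simp add: GF_def power_mult_distrib)

lemma GF_divide: "x \<in> GF q \<Longrightarrow> y \<in> GF q \<Longrightarrow> x / y \<in> GF q"
  by (simp add: GF_def power_divide)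

lemma GF_uminus: "m > 0 \<Longrightarrow> x \<in> GF (2 ^ m) \<Longrightarrow> - x \<in> GF (2 ^ m)"
  by (simp only: GF_def mem_Collect_eq power_q_uminus)

text \<open>For a prime power q, \<open>x ^ (q + 1)\<close> is the norm from the field of order q^2
  to the one of order q. It is fixed by the q-th power map because that map sends x to x^q and x^q
  back to x.\<close>

lemma GF_norm: "x \<in> GF (q\<^sup>2) \<Longrightarrow> x ^ (q + 1) \<in> GF q"
  by (simp add: GF_def power_mult_distrib power2_eq_square power_mult)

section \<open>Point-line incidences in an affine plane\<close>

text \<open>Points \<open>(x, y)\<close> are joined to the non-vertical lines y = k x + b through
  them. Two points lie on at most one such line, so there is not even a biclique with two vertices
  on each side. An incidence is determined by \<open>x\<close>, \<open>k\<close> and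
  \<open>b\<close>, which gives q^3 edges.\<close>

lemma K22_free_graph:
  assumes "m > 0" and q: "q = 2 ^ m"
  obtains E where "biclique_free 3 2 E" "E \<subseteq> {..<q^2} \<times> {..<q^2}" "card E = q ^ 3"
proof -
  let ?F = "GF q"
  have F: "finite ?F" "card ?F = q"
    using assms finite_GF card_GF by auto
  define h :: "F2bar \<times> F2bar \<times> F2bar \<Rightarrow> (F2bar \<times> F2bar) \<times> (F2bar \<times> F2bar)"
    where "h = (\<lambda>(x, k, b). ((x, k * x + b), (k, b)))"
  define E where "E = h ` (?F \<times> ?F \<times> ?F)"
  have "inj_on h (?F \<times> ?F \<times> ?F)"
    by (auto simp: h_def inj_on_def)
  then have cE: "card E = q ^ 3"
    using F by (simp add: E_def card_image card_cartesian_product power3_eq_cube)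
  have "biclique_free 2 2 E"
    unfolding biclique_free_def
  proof (intro allI impI notI)
    fix I J assume *: "card I = 2 \<and> card J = 2" "I \<times> J \<subseteq> E"
    then obtain x y x' y' k b k' b' where
      I: "I = {(x, y), (x', y')}" "(x, y) \<noteq> (x', y')" and
      J: "J = {(k, b), (k', b')}" "(k, b) \<noteq> (k', b')"
      by (auto simp: card_2_iff)
    have line: "v = l * u + c" if "(u, v) \<in> I" "(l, c) \<in> J" for u v l c
      using that *(2) by (force simp: E_def h_def)
    have e: "y = k * x + b" "y' = k * x' + b" "y = k' * x + b'" "y' = k' * x' + b'"
      using line I(1) J(1) by auto
    have s: "k * x + b = k' * x + b'" "k * x' + b = k' * x' + b'"
      using e by auto
    \<comment> \<open>This second difference vanishes, so the slopes or the abscissae agree. Equal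
      slopes force \<open>b = b'\<close>, equal abscissae force \<open>y = y'\<close>; both
      contradict distinctness.\<close>
    have "(k - k') * (x - x') = (k * x + b - (k' * x + b')) - (k * x' + b - (k' * x' + b'))"
      by (simp add: algebra_simps)
    then have "(k - k') * (x - x') = 0"
      by (simp only: s diff_self)
    then show False
      using e I(2) J(2) by auto
  qed
  then have "biclique_free 3 2 E"
    by (rule biclique_free_mono) simp
  moreover have "E \<subseteq> (?F \<times> ?F) \<times> (?F \<times> ?F)"
    by (auto simp: E_def h_def q intro!: GF_add GF_mult)
  ultimately show thesis
    using biclique_free_transport[of 3 2 E "?F \<times> ?F" "?F \<times> ?F" "q^2"] F cE that
    by (auto simp: card_cartesian_product power2_eq_square)
qed

section \<open>The projective norm graph\<close>

text \<open>Dividing differences of the values by the differences of the roots gives two linear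
  relations, and subtracting these leaves \<open>a * (y - z) = 0\<close>.\<close>

lemma quadratic_three_roots:
  fixes a b c :: "'a :: field"
  assumes "a * x\<^sup>2 + b * x + c = 0" "a * y\<^sup>2 + b * y + c = 0" "a * z\<^sup>2 + b * z + c = 0"
    and "x \<noteq> y" "x \<noteq> z" "y \<noteq> z"
  shows "a = 0"
proof -
  have "(x - y) * (a * (x + y) + b) = (a * x\<^sup>2 + b * x + c) - (a * y\<^sup>2 + b * y + c)"
    "(x - z) * (a * (x + z) + b) = (a * x\<^sup>2 + b * x + c) - (a * z\<^sup>2 + b * z + c)"
    by (simp_all add: algebra_simps power2_eq_square)
  then have "a * (x + y) + b = 0" "a * (x + z) + b = 0"
    using assms by simp_all
  moreover have "a * (y - z) = (a * (x + y) + b) - (a * (x + z) + b)"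
    by (simp add: algebra_simps)
  ultimately have "a * (y - z) = 0" by simp
  with assms(6) show ?thesis by simp
qed

text \<open>Common neighbours in the projective norm graph: \<open>\<phi>\<close> is the Frobenius \<open>x \<mapsto> x ^ q\<close>.
  Dividing the equations of the first two vertices by that of the third one leaves
  two equations in \<open>Y = 1 / (U + A\<^sub>3)\<close> and \<open>\<phi> Y\<close> with the same bilinear part up to a factor,
  so \<open>\<phi> Y\<close> is an affine function of \<open>Y\<close>, and \<open>Y\<close> is a root of a fixed quadratic polynomial.\<close>

lemma norm_graph_quadratic:
  fixes A1 A2 A3 a1 a2 a3 :: "'a :: field" and \<phi> :: "'a \<Rightarrow> 'a"
  assumes \<phi>: "\<And>x y. \<phi> (x + y) = \<phi> x + \<phi> y" "\<And>x y. \<phi> (x - y) = \<phi> x - \<phi> y"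
      "\<And>x. \<phi> x = 0 \<longleftrightarrow> x = 0" "\<And>x y. \<phi> (x / y) = \<phi> x / \<phi> y" "\<phi> 1 = 1"
    and nz: "a3 \<noteq> 0" and dist: "A1 \<noteq> A2" "A1 \<noteq> A3" "A2 \<noteq> A3"
  obtains a b c where "a \<noteq> 0"
    "\<And>U x. x \<noteq> 0 \<Longrightarrow> (U + A1) * \<phi> (U + A1) = a1 * x \<Longrightarrow> (U + A2) * \<phi> (U + A2) = a2 * x \<Longrightarrow>
       (U + A3) * \<phi> (U + A3) = a3 * x \<Longrightarrow>
       a * (1 / (U + A3))\<^sup>2 + b * (1 / (U + A3)) + c = 0"
proof -
  define D1 D2 where "D1 = A1 - A3" and "D2 = A2 - A3"
  have D: "D1 \<noteq> 0" "D2 \<noteq> 0" "D1 \<noteq> D2"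
    using dist by (auto simp: D1_def D2_def)
  define E1 E2 where "E1 = \<phi> D1" and "E2 = \<phi> D2"
  have "\<phi> (D1 - D2) \<noteq> 0"
    using \<phi>(3) D by simp
  then have E: "E1 \<noteq> 0" "E2 \<noteq> 0" "E1 \<noteq> E2"
    using D \<phi>(2,3) by (auto simp: E1_def E2_def)
  define r1 r2 where "r1 = a1 / a3 - 1" and "r2 = a2 / a3 - 1"
  \<comment> \<open>The coefficients of the relation \<open>u * Y + v * Y' = w\<close> that remains
    when the product \<open>Y * Y'\<close> is eliminated from the two equations \<open>k\<close>
    below. Both \<open>u\<close> and \<open>v\<close> are nonzero because the \<open>D\<close>s and
    their images under \<open>\<phi>\<close> are nonzero and distinct.\<close>
  define u v w where "u = D1 * D2 * (E2 - E1)" and "v = E1 * E2 * (D2 - D1)"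
    and "w = r1 * (D2 * E2) - r2 * (D1 * E1)"
  have uv: "u \<noteq> 0" "v \<noteq> 0"
    using D E by (auto simp: u_def v_def)
  show thesis
  proof
    show "- (D1 * E1 * u) \<noteq> 0" using D E uv by simp
  next
    fix U x
    assume x: "x \<noteq> 0" and e1: "(U + A1) * \<phi> (U + A1) = a1 * x"
      and e2: "(U + A2) * \<phi> (U + A2) = a2 * x"
      and e3: "(U + A3) * \<phi> (U + A3) = a3 * x"
    define Y Y' where "Y = 1 / (U + A3)" and "Y' = \<phi> Y"
    have XA: "U + A3 \<noteq> 0" "\<phi> (U + A3) \<noteq> 0"
      using e3 x nz by auto
    have Y': "Y' = 1 / \<phi> (U + A3)"
      by (simp add: Y'_def Y_def \<phi>(4,5))
    \<comment> \<open>Each factor \<open>U + A\<close> is written as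
      \<open>(U + A3) + (A - A3)\<close> and divided by \<open>U + A3\<close>; the unknown
      \<open>x\<close> cancels against the third equation.\<close>
    have key: "(1 + (A - A3) * Y) * (1 + \<phi> (A - A3) * Y') = \<alpha> / a3"
      if "(U + A) * \<phi> (U + A) = \<alpha> * x" for A \<alpha>
    proof -
      have "(1 + (A - A3) * Y) = (U + A) / (U + A3)"
        using XA by (simp add: Y_def field_simps)
      moreover have "1 + \<phi> (A - A3) * Y' = \<phi> (U + A) / \<phi> (U + A3)"
        using XA \<phi>(1)[of "U + A3" "A - A3"] by (simp add: Y' field_simps)
      ultimately have "(1 + (A - A3) * Y) * (1 + \<phi> (A - A3) * Y') = (\<alpha> * x) / (a3 * x)"
        using that e3 by simp
      with x show ?thesis by simp
    qed
    define Z where "Z = Y * Y'"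
    have k: "D1 * Y + E1 * Y' + D1 * E1 * Z = r1" "D2 * Y + E2 * Y' + D2 * E2 * Z = r2"
      using key[OF e1] key[OF e2]
      by (simp_all add: D1_def E1_def D2_def E2_def r1_def r2_def Z_def algebra_simps)
    have "u * Y + v * Y' = (D1 * Y + E1 * Y' + D1 * E1 * Z) * (D2 * E2) - (D2 * Y + E2 * Y' + D2 * E2 * Z) * (D1 * E1)"
      by (simp add: u_def v_def algebra_simps)
    then have "u * Y + v * Y' = w"
      by (simp only: k w_def)
    then have lin: "v * Y' = w - u * Y"
      by (simp add: eq_diff_eq add.commute)
    \<comment> \<open>The first equation is multiplied by \<open>v\<close>, so that
      \<open>Y'\<close> occurs only as \<open>v * Y'\<close> and can be replaced by
      \<open>w - u * Y\<close> without division.\<close>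
    have "v * (D1 * Y) + E1 * (v * Y') + D1 * E1 * Y * (v * Y') = v * (D1 * Y + E1 * Y' + D1 * E1 * Z)"
      by (simp add: Z_def algebra_simps)
    then have "v * (D1 * Y) + E1 * (w - u * Y) + D1 * E1 * Y * (w - u * Y) = v * r1"
      by (simp only: lin k)
    moreover have "- (D1 * E1 * u) * Y\<^sup>2 + (v * D1 - E1 * u + D1 * E1 * w) * Y + (E1 * w - v * r1)
        = v * (D1 * Y) + E1 * (w - u * Y) + D1 * E1 * Y * (w - u * Y) - v * r1"
      by (simp add: power2_eq_square algebra_simps)
    ultimately show "- (D1 * E1 * u) * (1 / (U + A3))\<^sup>2 + (v * D1 - E1 * u + D1 * E1 * w) * (1 / (U + A3))
        + (E1 * w - v * r1) = 0"
      by (simp add: Y_def)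
  qed
qed

text \<open>Both sides are pairs of an element of the field of order q^2 and a nonzero element of
  the field of order q; \<open>(A, a)\<close> and \<open>(B, b)\<close> are adjacent when the norm
  of \<open>A + B\<close> is \<open>a * b\<close>. Three common neighbours of three vertices would
  give three distinct roots of one quadratic.\<close>

lemma K33_free_graph:
  assumes "m > 0" and q: "q = 2 ^ m"
  obtains E where "biclique_free 3 3 E" "E \<subseteq> {..<q^3} \<times> {..<q^3}" "4 * card E \<ge> q ^ 5"
proof -
  let ?F = "GF q - {0}" and ?K = "GF (q\<^sup>2)"
  have q2: "q \<ge> 2"
    using assms self_le_power[of 2 m] by simp
  have F: "finite ?F" "card ?F = q - 1"
    using assms finite_GF card_GF by (auto simp: GF_def)
  have qq: "q\<^sup>2 = 2 ^ (m * 2)"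
    by (simp add: q power_mult)
  have K: "finite ?K" "card ?K = q\<^sup>2"
    using assms finite_GF[of "m * 2"] card_GF[of "m * 2"] unfolding qq by auto
  define V where "V = ?K \<times> ?F"
  have cV: "finite V" "card V \<le> q ^ 3"
    using F K by (auto simp: V_def card_cartesian_product power2_eq_square power3_eq_cube)
  define E where "E = {((A, a), (B, b)) | A a B b. (A, a) \<in> V \<and> (B, b) \<in> V \<and> (A + B) ^ (q + 1) = a * b}"
  have EV: "E \<subseteq> V \<times> V" by (auto simp: E_def)
  \<comment> \<open>Edges are parametrised by \<open>A\<close>, \<open>a\<close> and
    \<open>B\<close>, since \<open>b\<close> is then determined. The value \<open>B = -A\<close> is
    excluded because it would give \<open>b = 0\<close>.\<close>
  define W where "W = (SIGMA A:?K. ?F \<times> (?K - {-A}))"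
  define h where "h = (\<lambda>(A, a, B). ((A, a), (B, (A + B) ^ (q + 1) / a :: F2bar)))"
  have neg: "- A \<in> ?K" if "A \<in> ?K" for A
    using that GF_uminus[of "m * 2"] assms qq by auto
  have add: "A + B \<in> ?K" if "A \<in> ?K" "B \<in> ?K" for A B
    using that GF_add[of _ "m * 2"] qq by auto
  have "h ` W \<subseteq> E"
  proof (rule image_subsetI)
    fix w assume "w \<in> W"
    moreover obtain A a B where w: "w = (A, a, B)" by (cases w)
    ultimately have *: "A \<in> ?K" "a \<in> ?F" "B \<in> ?K" "A + B \<noteq> 0"
      by (auto simp: W_def w add_eq_0_iff2)
    then have "(A + B) ^ (q + 1) / a \<in> ?F"
      using GF_divide[OF GF_norm[OF add]] by auto
    with * show "h w \<in> E"
      by (auto simp: w h_def E_def V_def)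
  qed
  moreover have "finite E"
    using EV cV finite_subset by blast
  moreover have "inj_on h W"
    by (auto simp: inj_on_def h_def)
  ultimately have "card W \<le> card E"
    by (metis card_image card_mono)
  moreover have "card W = q\<^sup>2 * ((q - 1) * (q\<^sup>2 - 1))"
    using F K neg unfolding W_def by (subst card_SigmaI) (auto simp: card_cartesian_product)
  ultimately have W: "q\<^sup>2 * ((q - 1) * (q\<^sup>2 - 1)) \<le> card E" by simp
  \<comment> \<open>Replacing q - 1 and q^2 - 1 by q and q^2 costs a factor 2 each, whence the 4 in
    the conclusion.\<close>
  have "q \<le> 2 * (q - 1)" "q\<^sup>2 \<le> 2 * (q\<^sup>2 - 1)"
    using q2 by (auto simp: power2_eq_square) (use q2 mult_le_mono[of 2 q 2 q] in linarith)
  then have "q * q\<^sup>2 \<le> (2 * (q - 1)) * (2 * (q\<^sup>2 - 1))"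
    by (rule mult_le_mono)
  then have "q\<^sup>2 * (q * q\<^sup>2) \<le> q\<^sup>2 * ((2 * (q - 1)) * (2 * (q\<^sup>2 - 1)))"
    by (rule mult_le_mono2)
  also have "\<dots> = 4 * (q\<^sup>2 * ((q - 1) * (q\<^sup>2 - 1)))"
    by (simp add: mult_ac)
  also have "\<dots> \<le> 4 * card E"
    using W by simp
  finally have cE: "q ^ 5 \<le> 4 * card E"
    by (simp add: power2_eq_square eval_nat_numeral mult_ac)
  have "biclique_free 3 3 E"
    unfolding biclique_free_def
  proof (intro allI impI notI)
    fix I J assume *: "card I = 3 \<and> card J = 3" "I \<times> J \<subseteq> E"
    then obtain A1 a1 A2 a2 A3 a3 B1 b1 B2 b2 B3 b3 where
      I: "I = {(A1, a1), (A2, a2), (A3, a3)}"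
         "(A1, a1) \<noteq> (A2, a2)" "(A1, a1) \<noteq> (A3, a3)" "(A2, a2) \<noteq> (A3, a3)" and
      J: "J = {(B1, b1), (B2, b2), (B3, b3)}"
         "(B1, b1) \<noteq> (B2, b2)" "(B1, b1) \<noteq> (B3, b3)" "(B2, b2) \<noteq> (B3, b3)"
      unfolding card_3_iff by (metis surj_pair)
    have adj: "a \<noteq> 0 \<and> b \<noteq> 0 \<and> (B + A) * (B + A) ^ q = a * b"
      if "(A, a) \<in> I" "(B, b) \<in> J" for A a B b
      using that *(2) by (force simp: E_def V_def add.commute)
    \<comment> \<open>Given a common neighbour \<open>(B, b)\<close>, the norm of
      \<open>A + B\<close> divided by \<open>b\<close> recovers \<open>a\<close>. So distinct
      vertices of a biclique already differ in the first coordinate, which is the distinctness that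
      the quadratic argument needs.\<close>
    have II: "A \<noteq> A'" if "(A, a) \<in> I" "(A', a') \<in> I" "(A, a) \<noteq> (A', a')" for A a A' a'
      using that adj[of A a B1 b1] adj[of A' a' B1 b1] J by auto
    have JJ: "B \<noteq> B'" if "(B, b) \<in> J" "(B', b') \<in> J" "(B, b) \<noteq> (B', b')" for B b B' b'
      using that adj[of A1 a1 B b] adj[of A1 a1 B' b'] I by auto
    have A: "A1 \<noteq> A2" "A1 \<noteq> A3" "A2 \<noteq> A3"
      using II I by auto
    have B: "B1 \<noteq> B2" "B1 \<noteq> B3" "B2 \<noteq> B3"
      using JJ J by auto
    have "a3 \<noteq> 0" using adj I J by auto
    \<comment> \<open>The quadratic depends on \<open>I\<close> only. A neighbour
      \<open>(B, b)\<close> of all of \<open>I\<close> enters as \<open>U = B\<close>,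
      \<open>x = b\<close>, and the three equations are its adjacencies.\<close>
    obtain a b c where "a \<noteq> 0" and
      eq: "\<And>U x. x \<noteq> 0 \<Longrightarrow> (U + A1) * (U + A1) ^ q = a1 * x \<Longrightarrow> (U + A2) * (U + A2) ^ q = a2 * x \<Longrightarrow>
       (U + A3) * (U + A3) ^ q = a3 * x \<Longrightarrow>
       a * (1 / (U + A3))\<^sup>2 + b * (1 / (U + A3)) + c = 0"
      by (rule norm_graph_quadratic[of "\<lambda>x. x ^ q" a3 A1 A2 A3 a1 a2])
        (use A \<open>a3 \<noteq> 0\<close> assms in \<open>auto simp: power_q_add power_q_diff power_divide\<close>)
    have root: "a * (1 / (U + A3))\<^sup>2 + b * (1 / (U + A3)) + c = 0" if "(U, x) \<in> J" for U x
      using eq[of x U] adj[OF _ that] I(1) by auto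
    have nz: "U + A3 \<noteq> 0" if "(U, x) \<in> J" for U x
      using adj[OF _ that, of A3 a3] I(1) by auto
    have "1 / (B1 + A3) \<noteq> 1 / (B2 + A3)" "1 / (B1 + A3) \<noteq> 1 / (B3 + A3)"
      "1 / (B2 + A3) \<noteq> 1 / (B3 + A3)"
      using B nz J(1) by (auto simp: divide_simps)
    then have "a = 0"
      using root J(1) by (intro quadratic_three_roots[of a "1 / (B1 + A3)" b c "1 / (B2 + A3)" "1 / (B3 + A3)"]) auto
    with \<open>a \<noteq> 0\<close> show False by simp
  qed
  then obtain E' where "biclique_free 3 3 E'" "E' \<subseteq> {..<q^3} \<times> {..<q^3}" "card E' = card E"
    by (rule biclique_free_transport[OF _ EV _ _ cV(1) cV(1) cV(2) cV(2)]) simp_all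
  with cE show thesis
    using that by simp
qed

section \<open>Crosses in planar sets of large area\<close>

text \<open>\<open>G\<close> is the distribution function of \<open>U\<close>; from \<open>x\<close>
  to \<open>y\<close> it gains at most the length of the interval between them. Since
  \<open>G\<close> is 1-Lipschitz, any right inverse of it has slope at least 1, and this is the
  source of all expanding maps below.\<close>

lemma cumulative_lipschitz:
  fixes U :: "real set"
  assumes "U \<in> sets borel" "emeasure lborel U < \<infinity>" "x \<le> y"
  defines "G \<equiv> \<lambda>y. measure lborel (U \<inter> {..y})"
  shows "G x \<le> G y" "G y \<le> G x + (y - x)"
proof -
  have fin: "U \<inter> A \<in> fmeasurable lborel" if "A \<in> sets borel" for A
  proof (rule fmeasurableI2[of U])
    show "U \<in> fmeasurable lborel"
      using assms(1,2) by (intro fmeasurableI) auto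
    show "U \<inter> A \<in> sets lborel"
      using assms(1) that by simp
  qed simp
  show "G x \<le> G y"
    unfolding G_def using assms(1,3) fin by (intro measure_mono_fmeasurable) auto
  have "G y \<le> measure lborel (U \<inter> {..x} \<union> {x..y})"
    unfolding G_def using fin[of "{..x}"] assms(1,3)
    by (intro measure_mono_fmeasurable fmeasurable.Un) (auto simp: fmeasurable_def)
  also have "\<dots> \<le> measure lborel (U \<inter> {..x}) + measure lborel {x..y}"
    using assms(1) by (intro measure_Un_le) auto
  finally show "G y \<le> G x + (y - x)"
    using assms(3) by (simp add: G_def)
qed

lemma cumulative_continuous:
  fixes U :: "real set"
  assumes "U \<in> sets borel" "emeasure lborel U < \<infinity>"
  shows "continuous_on UNIV (\<lambda>y. measure lborel (U \<inter> {..y}))"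
proof (rule lipschitz_on_continuous_on[of 1], rule lipschitz_onI)
  fix x y :: real
  show "dist (measure lborel (U \<inter> {..x})) (measure lborel (U \<inter> {..y})) \<le> 1 * dist x y"
    using cumulative_lipschitz[OF assms, of x y] cumulative_lipschitz[OF assms, of y x]
    by (cases "x \<le> y") (auto simp: dist_real_def)
qed simp

text \<open>\<open>g s\<close> is chosen as a point of \<open>K\<close> with exactly measure
  \<open>s\<close> of \<open>K\<close> up to it; expansion is then the Lipschitz bound for
  \<open>G\<close> read backwards.\<close>

lemma expanding_into_compact:
  fixes K :: "real set"
  assumes K: "compact K" "K \<subseteq> {a<..}" and d: "d \<le> measure lborel K"
  obtains g where "g 0 = a" "\<And>s. 0 < s \<Longrightarrow> s \<le> d \<Longrightarrow> g s \<in> K"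
    "\<And>s s'. 0 \<le> s \<Longrightarrow> s < s' \<Longrightarrow> s' \<le> d \<Longrightarrow> s' - s \<le> g s' - g s"
proof -
  define G where "G y = measure lborel (K \<inter> {..y})" for y
  have meas: "K \<in> sets borel" "emeasure lborel K < \<infinity>"
    using emeasure_bounded_finite[OF compact_imp_bounded[OF K(1)]] borel_compact[OF K(1)] by auto
  have lip: "G x \<le> G y" "G y \<le> G x + (y - x)" if "x \<le> y" for x y
    using cumulative_lipschitz[OF meas that] by (auto simp: G_def)
  have cont: "continuous_on A G" for A
    using continuous_on_subset[OF cumulative_continuous[OF meas]] by (auto simp: G_def)
  have Ga: "G a = 0"
  proof -
    have "K \<inter> {..a} = {}" using K(2) by auto
    then show ?thesis by (simp add: G_def)
  qed
  obtain b where b: "\<And>x. x \<in> K \<Longrightarrow> x \<le> b"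
    using compact_imp_bounded[OF K(1)] bounded_has_Sup(1) by (meson bdd_above_def bounded_imp_bdd_above)
  have "K \<inter> {..b} = K" using b by auto
  then have Gb: "G b = measure lborel K" by (simp add: G_def)
  have ex: "\<exists>y. y \<in> K \<and> G y = s" if s: "0 < s" "s \<le> d" for s
  proof -
    have "a \<le> b"
      using lip(1)[of b a] Ga Gb s d by linarith
    then obtain y where y: "G y = s"
      using IVT'[of G a s b] cont Ga Gb s d by auto
    \<comment> \<open>The point \<open>y\<close> found by the intermediate value theorem may lie in
      a gap of \<open>K\<close>. Compactness allows moving down to the last point of
      \<open>K\<close> before it, which leaves \<open>G\<close> unchanged.\<close>
    let ?A = "K \<inter> {..y}"
    have "?A \<noteq> {}"
      using y s(1) by (auto simp: G_def)
    moreover have "compact ?A"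
      using K(1) by (simp add: compact_Int_closed)
    ultimately obtain y0 where y0: "y0 \<in> ?A" "\<And>x. x \<in> ?A \<Longrightarrow> x \<le> y0"
      using compact_attains_sup[of ?A] by auto
    then have "K \<inter> {..y0} = ?A" by auto
    then have "G y0 = s"
      using y by (simp add: G_def)
    then show ?thesis using y0(1) by auto
  qed
  \<comment> \<open>The value at 0 is set by hand: \<open>a\<close> has \<open>G a = 0\<close> but
    lies outside \<open>K\<close>.\<close>
  define g where "g s = (if s = 0 then a else SOME y. y \<in> K \<and> G y = s)" for s
  have g: "g s \<in> K" "G (g s) = s" if "0 < s" "s \<le> d" for s
    using someI_ex[OF ex[OF that]] that by (auto simp: g_def)
  have Gg: "G (g s) = s" if "0 \<le> s" "s \<le> d" for s
    using that g Ga by (cases "s = 0") (auto simp: g_def)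
  show thesis
  proof (rule that)
    show "g 0 = a" by (simp add: g_def)
    show "g s \<in> K" if "0 < s" "s \<le> d" for s
      using g that by auto
    show "s' - s \<le> g s' - g s" if "0 \<le> s" "s < s'" "s' \<le> d" for s s'
      using Gg[of s] Gg[of s'] that lip[of "g s" "g s'"] lip[of "g s'" "g s"] by linarith
  qed
qed

text \<open>Inner regularity of Lebesgue measure; the strict excess of the measure of
  \<open>U\<close> over \<open>d\<close> is the loss that may be incurred.\<close>

lemma compact_inner_approx:
  fixes U :: "real set"
  assumes "open U" "bounded U" "ennreal d < emeasure lborel U" "d \<ge> 0"
  obtains K where "compact K" "K \<subseteq> U" "d \<le> measure lborel K"
proof -
  have U: "U \<in> sets borel" "emeasure lborel U < \<infinity>"
    using assms emeasure_bounded_finite by auto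
  then have Um: "emeasure lborel U = ennreal (measure lborel U)"
    by (intro emeasure_eq_ennreal_measure) auto
  then have pos: "0 < measure lborel U - d"
    using assms(3,4) by (auto simp: ennreal_less_iff)
  have "U \<in> sets lebesgue" using U by auto
  then obtain T where
    T: "closed T" "T \<subseteq> U" "emeasure lebesgue (U - T) < ennreal (measure lborel U - d)"
    using pos by (rule sets_lebesgue_inner_closed)
  have "compact T"
    using T assms(2) bounded_subset compact_eq_bounded_closed by blast
  have Tm: "T \<in> sets borel" "emeasure lborel T < \<infinity>"
    using emeasure_bounded_finite[OF compact_imp_bounded] borel_compact \<open>compact T\<close> by auto
  then have eT: "emeasure lborel T = ennreal (measure lborel T)"
    by (intro emeasure_eq_ennreal_measure) auto
  have "emeasure lebesgue (U - T) = emeasure lborel (U - T)"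
    using U Tm by simp
  then have "emeasure lborel (U - T) \<le> ennreal (measure lborel U - d)"
    using T(3) by simp
  moreover have "emeasure lborel U = emeasure lborel T + emeasure lborel (U - T)"
    using U Tm T(2) by (subst plus_emeasure) (auto simp: Un_absorb1)
  ultimately have "ennreal (measure lborel U) \<le> ennreal (measure lborel T) + ennreal (measure lborel U - d)"
    using Um eT by (metis add_left_mono)
  then have "measure lborel U \<le> measure lborel T + (measure lborel U - d)"
    using pos by (simp flip: ennreal_plus)
  then show thesis
    using that[of T] \<open>compact T\<close> T by auto
qed

lemma emeasure_lborel_uminus:
  fixes A :: "real set"
  assumes "A \<in> sets borel"
  shows "emeasure lborel (uminus ` A) = emeasure lborel A"
proof -
  have "emeasure lborel A = emeasure (distr lborel borel uminus) A"
    by (simp add: lborel_distr_uminus)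
  also have "\<dots> = emeasure lborel (uminus -` A)"
    using assms by (subst emeasure_distr) auto
  also have "uminus -` A = uminus ` A"
    by (force simp: image_iff)
  finally show ?thesis by simp
qed

text \<open>Two one-sided maps are glued at 0. The right one comes from a compact subset of
  \<open>U\<close> to the right of \<open>a\<close>, the left one from the same construction for the
  reflected set.\<close>

lemma expanding_into_open:
  fixes U :: "real set"
  assumes U: "open U" "bounded U" "a \<in> U" and "d > 0"
    and left: "ennreal d < emeasure lborel (U \<inter> {..<a})"
    and right: "ennreal d < emeasure lborel (U \<inter> {a<..})"
  obtains f where "f 0 = a" "\<And>s. s \<in> {-d..d} \<Longrightarrow> f s \<in> U"
    "\<And>s s'. -d \<le> s \<Longrightarrow> s < s' \<Longrightarrow> s' \<le> d \<Longrightarrow> s' - s \<le> f s' - f s"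
proof -
  have half: "\<exists>g. g 0 = b \<and> (\<forall>s. 0 < s \<and> s \<le> d \<longrightarrow> g s \<in> V) \<and>
      (\<forall>s s'. 0 \<le> s \<and> s < s' \<and> s' \<le> d \<longrightarrow> s' - s \<le> g s' - g s)"
    if V: "open V" "bounded V" "ennreal d < emeasure lborel (V \<inter> {b<..})" for V b
  proof -
    obtain K where K: "compact K" "K \<subseteq> V \<inter> {b<..}" "d \<le> measure lborel K"
      using V \<open>d > 0\<close> by (rule_tac compact_inner_approx[of "V \<inter> {b<..}" d]) (auto intro: bounded_subset)
    then obtain g where "g 0 = b" "\<And>s. 0 < s \<Longrightarrow> s \<le> d \<Longrightarrow> g s \<in> K"
      "\<And>s s'. 0 \<le> s \<Longrightarrow> s < s' \<Longrightarrow> s' \<le> d \<Longrightarrow> s' - s \<le> g s' - g s"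
      using expanding_into_compact[of K b d] by auto
    then show ?thesis using K(2) by blast
  qed
  obtain g where g: "g 0 = a" "\<And>s. 0 < s \<Longrightarrow> s \<le> d \<Longrightarrow> g s \<in> U"
      "\<And>s s'. 0 \<le> s \<Longrightarrow> s < s' \<Longrightarrow> s' \<le> d \<Longrightarrow> s' - s \<le> g s' - g s"
    using half[OF U(1,2) right] by blast
  have "uminus ` U \<inter> {-a<..} = uminus ` (U \<inter> {..<a})" by auto
  then have "ennreal d < emeasure lborel (uminus ` U \<inter> {-a<..})"
    using left emeasure_lborel_uminus[of "U \<inter> {..<a}"] U(1) by auto
  with U obtain h where
    h: "h 0 = -a" "\<And>s. 0 < s \<Longrightarrow> s \<le> d \<Longrightarrow> h s \<in> uminus ` U"
      "\<And>s s'. 0 \<le> s \<Longrightarrow> s < s' \<Longrightarrow> s' \<le> d \<Longrightarrow> s' - s \<le> h s' - h s"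
    using half[of "uminus ` U" "-a"] by (auto simp: open_negations bounded_uminus)
  define f where "f s = (if s \<ge> 0 then g s else - h (- s))" for s
  show thesis
  proof (rule that)
    show "f 0 = a" by (simp add: f_def g)
    show "f s \<in> U" if "s \<in> {-d..d}" for s
    proof -
      consider "s = 0" | "s > 0" | "s < 0" by linarith
      then show ?thesis
        using that g(1) g(2)[of s] h(2)[of "-s"] U(3) by cases (auto simp: f_def)
    qed
    show "s' - s \<le> f s' - f s" if "-d \<le> s" "s < s'" "s' \<le> d" for s s'
    proof -
      \<comment> \<open>When \<open>s\<close> and \<open>s'\<close> lie on different sides of 0, the
        two one-sided estimates are added through the common value \<open>f 0 = a\<close>.\<close>
      consider "0 \<le> s" | "s' < 0" | "s < 0" "0 = s'" | "s < 0" "0 < s'" by linarith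
      then show ?thesis
      proof cases
        case 1 with that g(3)[of s s'] show ?thesis by (simp add: f_def)
      next
        case 2 with that h(3)[of "-s'" "-s"] show ?thesis by (simp add: f_def)
      next
        case 3 with that h(3)[of 0 "-s"] g(1) h(1) show ?thesis by (simp add: f_def)
      next
        case 4 with that h(3)[of 0 "-s"] g(3)[of 0 s'] g(1) h(1) show ?thesis by (simp add: f_def)
      qed
    qed
  qed
qed

text \<open>The set lies in \<open>U \<inter> {..s}\<close> for its supremum \<open>s\<close>. Since
  \<open>G\<close> is continuous, its bound \<open>d\<close> persists at \<open>s\<close>, so this
  larger set has measure at most \<open>d\<close>.\<close>

lemma emeasure_near_left_end:
  fixes U :: "real set"
  assumes U: "U \<in> sets borel" "bounded U" and "d \<ge> 0"
  shows "emeasure lborel {a \<in> U. emeasure lborel (U \<inter> {..<a}) \<le> ennreal d} \<le> ennreal d"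
    (is "emeasure lborel ?V \<le> _")
proof (cases "?V = {}")
  case False
  define G where "G y = measure lborel (U \<inter> {..y})" for y
  have fin: "emeasure lborel U < \<infinity>"
    using U(2) emeasure_bounded_finite by auto
  have eG: "emeasure lborel (U \<inter> {..y}) = ennreal (G y)" for y
  proof -
    have "emeasure lborel (U \<inter> {..y}) \<le> emeasure lborel U"
      using U by (intro emeasure_mono) auto
    then show ?thesis
      unfolding G_def using fin by (intro emeasure_eq_ennreal_measure) (auto simp: top_unique)
  qed
  have closed: "closed {y. G y \<le> d}"
    using closed_Collect_le[OF cumulative_continuous[OF U(1) fin] continuous_on_const[of UNIV d]]
    by (simp add: G_def)
  have V: "?V \<subseteq> {y. G y \<le> d}"
  proof clarify
    fix a assume "a \<in> U" and a: "emeasure lborel (U \<inter> {..<a}) \<le> ennreal d"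
    \<comment> \<open>\<open>G\<close> counts the closed ray and \<open>?V\<close> the open one; the
      extra point has measure zero.\<close>
    have "emeasure lborel (U \<inter> {..a}) \<le> emeasure lborel ((U \<inter> {..<a}) \<union> {a})"
      using U by (intro emeasure_mono) auto
    also have "\<dots> \<le> emeasure lborel (U \<inter> {..<a}) + emeasure lborel {a}"
      using U by (intro emeasure_subadditive) auto
    also have "\<dots> \<le> ennreal d" using a by simp
    finally show "G a \<le> d" using assms(3) by (simp add: eG)
  qed
  have "bounded ?V"
    using U(2) by (rule bounded_subset) auto
  then have bdd: "bdd_above ?V" by (rule bounded_imp_bdd_above)
  define s where "s = Sup ?V"
  have "s \<in> closure ?V"
    unfolding s_def using False bdd by (rule closure_contains_Sup)
  also have "closure ?V \<subseteq> {y. G y \<le> d}"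
    using V closed by (rule closure_minimal)
  finally have "G s \<le> d" by simp
  have "?V \<subseteq> U \<inter> {..s}"
    using cSup_upper[OF _ bdd] by (auto simp: s_def)
  then have "emeasure lborel ?V \<le> emeasure lborel (U \<inter> {..s})"
    using U by (intro emeasure_mono) auto
  also have "\<dots> \<le> ennreal d"
    using \<open>G s \<le> d\<close> by (simp add: eG ennreal_leI)
  finally show ?thesis .
next
  case True
  show ?thesis unfolding True by simp
qed

text \<open>The reflection of the left case. Measurability of the set enters as a hypothesis because
  the reflection formula is for Borel sets.\<close>

lemma emeasure_near_right_end:
  fixes U :: "real set"
  assumes U: "U \<in> sets borel" "bounded U" and "d \<ge> 0"
    and V: "{a \<in> U. emeasure lborel (U \<inter> {a<..}) \<le> ennreal d} \<in> sets borel"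
  shows "emeasure lborel {a \<in> U. emeasure lborel (U \<inter> {a<..}) \<le> ennreal d} \<le> ennreal d"
    (is "emeasure lborel ?V \<le> _")
proof -
  have U': "uminus ` U \<in> sets borel"
  proof -
    have "uminus -` U \<inter> space borel \<in> sets (borel :: real measure)"
      using U(1) by (intro measurable_sets[of _ _ borel]) auto
    moreover have "uminus -` U = uminus ` U" by (force simp: image_iff)
    ultimately show ?thesis by simp
  qed
  have eq: "emeasure lborel (uminus ` U \<inter> {..<-a}) = emeasure lborel (U \<inter> {a<..})" for a
  proof -
    have "uminus ` U \<inter> {..<-a} = uminus ` (U \<inter> {a<..})" by auto
    then show ?thesis
      using U(1) emeasure_lborel_uminus[of "U \<inter> {a<..}"] by simp
  qed
  have "emeasure lborel ?V = emeasure lborel (uminus ` ?V)"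
    using V by (simp add: emeasure_lborel_uminus)
  also have "uminus ` ?V = {a \<in> uminus ` U. emeasure lborel (uminus ` U \<inter> {..<a}) \<le> ennreal d}"
    by (auto simp: eq)
  also have "emeasure lborel \<dots> \<le> ennreal d"
    using U' U(2) assms(3) by (intro emeasure_near_left_end) (auto simp: bounded_uminus)
  finally show ?thesis .
qed

text \<open>Outside this set a point of an open bounded \<open>T\<close> has more than
  \<open>d\<close> of its row on either side, and so carries a horizontal arm by
  \<open>expanding_into_open\<close>. Columns are handled by applying it to the transpose of
  \<open>T\<close>.\<close>

definition short_row :: "real \<Rightarrow> (real \<times> real) set \<Rightarrow> (real \<times> real) set" where
  "short_row d T = {p \<in> T.
     emeasure lborel ({x. (x, snd p) \<in> T} \<inter> {..<fst p}) \<le> ennreal d \<or>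
     emeasure lborel ({x. (x, snd p) \<in> T} \<inter> {fst p<..}) \<le> ennreal d}"

lemma row_open:
  fixes T :: "(real \<times> real) set"
  shows "open T \<Longrightarrow> open {x. (x, y) \<in> T}"
  using continuous_open_vimage[of T "\<lambda>x. (x, y)"] by (auto simp: vimage_def intro!: continuous_intros)

text \<open>The measure of the part of a row on one side of \<open>p\<close> is the measure of the
  fibre over \<open>p\<close> of an open set in the product of the plane and the line, hence a Borel
  function of \<open>p\<close>.\<close>

lemma sets_short_row:
  fixes T :: "(real \<times> real) set"
  assumes T: "open T"
  shows "{p \<in> T. emeasure lborel ({x. (x, snd p) \<in> T} \<inter> {..<fst p}) \<le> ennreal d} \<in> sets borel"
    "{p \<in> T. emeasure lborel ({x. (x, snd p) \<in> T} \<inter> {fst p<..}) \<le> ennreal d} \<in> sets borel"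
proof -
  have *: "{p \<in> T. emeasure lborel (Pair p -` W) \<le> ennreal d} \<in> sets borel"
    if W: "open W" for W :: "((real \<times> real) \<times> real) set"
  proof -
    have "sets (borel \<Otimes>\<^sub>M lborel) = sets (borel \<Otimes>\<^sub>M borel :: ((real \<times> real) \<times> real) measure)"
      by (rule sets_pair_measure_cong) simp_all
    then have "W \<in> sets (borel \<Otimes>\<^sub>M lborel)"
      using W by (simp only: borel_prod borel_open)
    then have [measurable]: "(\<lambda>p. emeasure lborel (Pair p -` W)) \<in> borel_measurable borel"
      by (rule lborel.measurable_emeasure_Pair)
    have [measurable]: "T \<in> sets borel"
      using T by simp
    show ?thesis by measurable
  qed
  have ops: "open ((\<lambda>q::(real \<times> real) \<times> real. (snd q, snd (fst q))) -` T)"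
    using T by (intro continuous_open_vimage) (auto intro!: continuous_intros)
  have "open ({q::(real \<times> real) \<times> real. snd q < fst (fst q)} \<inter> (\<lambda>q. (snd q, snd (fst q))) -` T)"
    using ops by (intro open_Int open_Collect_less) (auto intro!: continuous_intros)
  from *[OF this] show "{p \<in> T. emeasure lborel ({x. (x, snd p) \<in> T} \<inter> {..<fst p}) \<le> ennreal d} \<in> sets borel"
    by (simp add: vimage_def Int_def lessThan_def conj_commute)
  have "open ({q::(real \<times> real) \<times> real. fst (fst q) < snd q} \<inter> (\<lambda>q. (snd q, snd (fst q))) -` T)"
    using ops by (intro open_Int open_Collect_less) (auto intro!: continuous_intros)
  from *[OF this] show "{p \<in> T. emeasure lborel ({x. (x, snd p) \<in> T} \<inter> {fst p<..}) \<le> ennreal d} \<in> sets borel"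
    by (simp add: vimage_def Int_def greaterThan_def conj_commute)
qed

text \<open>Fubini over the rows at heights in \<open>{0..n}\<close>: each has at most
  \<open>d\<close> near its left end and at most \<open>d\<close> near its right end.\<close>

lemma emeasure_short_row:
  assumes T: "open T" "T \<subseteq> {0..n} \<times> {0..n}" and "d > 0" "n \<ge> 0"
  shows "short_row d T \<in> sets borel" "emeasure lborel (short_row d T) \<le> ennreal (2 * d * n)"
proof -
  define B where "B = short_row d T"
  define L where "L = {p \<in> T. emeasure lborel ({x. (x, snd p) \<in> T} \<inter> {..<fst p}) \<le> ennreal d}"
  define R where "R = {p \<in> T. emeasure lborel ({x. (x, snd p) \<in> T} \<inter> {fst p<..}) \<le> ennreal d}"
  have LR: "L \<in> sets borel" "R \<in> sets borel"
    using sets_short_row[OF T(1)] by (auto simp: L_def R_def)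
  have B: "B = L \<union> R"
    by (auto simp: B_def L_def R_def short_row_def)
  with LR have Bm: "B \<in> sets borel" by simp
  then show "short_row d T \<in> sets borel" by (simp add: B_def)
  have row: "emeasure lborel ((\<lambda>x. (x, y)) -` B) \<le> ennreal (2 * d) * indicator {0..n} y" for y
  proof (cases "y \<in> {0..n}")
    case False
    then have "(\<lambda>x. (x, y)) -` B = {}"
      using T(2) by (auto simp: B_def short_row_def)
    then show ?thesis by simp
  next
    case True
    define U where "U = {x. (x, y) \<in> T}"
    have U: "open U" "U \<subseteq> {0..n}"
      using T row_open by (auto simp: U_def)
    then have Ub: "U \<in> sets borel" "bounded U"
      using bounded_subset[OF bounded_closed_interval] by auto
    have meas: "(\<lambda>x. (x, y)) -` A \<in> sets borel" if "A \<in> sets borel" for A :: "(real \<times> real) set"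
    proof -
      have "(\<lambda>x::real. (x, y)) -` A \<inter> space borel \<in> sets borel"
        using that by (intro measurable_sets[of _ _ borel]) (auto intro!: borel_measurable_continuous_onI continuous_intros)
      then show ?thesis by simp
    qed
    have L: "(\<lambda>x. (x, y)) -` L = {a \<in> U. emeasure lborel (U \<inter> {..<a}) \<le> ennreal d}"
      by (auto simp: L_def U_def)
    have R: "(\<lambda>x. (x, y)) -` R = {a \<in> U. emeasure lborel (U \<inter> {a<..}) \<le> ennreal d}"
      by (auto simp: R_def U_def)
    have "emeasure lborel ((\<lambda>x. (x, y)) -` B) \<le> emeasure lborel ((\<lambda>x. (x, y)) -` L) + emeasure lborel ((\<lambda>x. (x, y)) -` R)"
      unfolding B vimage_Un using meas LR by (intro emeasure_subadditive) auto
    also have "emeasure lborel ((\<lambda>x. (x, y)) -` L) \<le> ennreal d"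
      unfolding L using Ub \<open>d > 0\<close> by (intro emeasure_near_left_end) auto
    also have "emeasure lborel ((\<lambda>x. (x, y)) -` R) \<le> ennreal d"
      unfolding R using Ub \<open>d > 0\<close> meas[OF LR(2)] unfolding R by (intro emeasure_near_right_end) auto
    finally have "emeasure lborel ((\<lambda>x. (x, y)) -` B) \<le> ennreal d + ennreal d"
      by (simp add: add_mono)
    also have "\<dots> = ennreal (2 * d)"
      using \<open>d > 0\<close> by (simp flip: ennreal_plus)
    finally show ?thesis using True by simp
  qed
  have "emeasure lborel B = emeasure (lborel \<Otimes>\<^sub>M lborel) B"
    by (simp add: lborel_prod)
  also have "\<dots> = (\<integral>\<^sup>+y. emeasure lborel ((\<lambda>x. (x, y)) -` B) \<partial>lborel)"
    using Bm by (intro lborel_pair.emeasure_pair_measure_alt2) (simp add: lborel_prod cong del: sets_pair_measure_cong)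
  also have "\<dots> \<le> (\<integral>\<^sup>+y. ennreal (2 * d) * indicator {0..n} y \<partial>lborel)"
    using row by (intro nn_integral_mono) auto
  also have "\<dots> = ennreal (2 * d) * ennreal n"
    using \<open>n \<ge> 0\<close> by (subst nn_integral_cmult_indicator) auto
  also have "\<dots> = ennreal (2 * d * n)"
    using \<open>d > 0\<close> by (simp add: ennreal_mult')
  finally show "emeasure lborel (short_row d T) \<le> ennreal (2 * d * n)"
    by (simp add: B_def)
qed

lemma emeasure_lborel_swap:
  fixes A :: "(real \<times> real) set"
  assumes "A \<in> sets borel"
  shows "emeasure lborel (prod.swap -` A) = emeasure lborel A"
proof -
  have "emeasure lborel A = emeasure (lborel \<Otimes>\<^sub>M lborel) A"
    by (simp add: lborel_prod)
  also have "lborel \<Otimes>\<^sub>M lborel = distr (lborel \<Otimes>\<^sub>M lborel) (lborel \<Otimes>\<^sub>M lborel) (\<lambda>(x::real, y::real). (y, x))"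
    by (rule lborel_pair.distr_pair_swap)
  also have "emeasure \<dots> A = emeasure (lborel \<Otimes>\<^sub>M lborel) ((\<lambda>(x, y). (y, x)) -` A)"
    using assms by (subst emeasure_distr[OF measurable_pair_swap'])
      (auto simp: lborel_prod space_pair_measure cong del: sets_pair_measure_cong)
  also have "(\<lambda>(x, y). (y, x)) -` A = prod.swap -` A"
    by auto
  finally show ?thesis by (simp add: lborel_prod)
qed

text \<open>The slope condition of containment, with the quotient cleared.\<close>

definition expanding_on :: "real set \<Rightarrow> (real \<Rightarrow> real) \<Rightarrow> bool" where
  "expanding_on A f \<longleftrightarrow> (\<forall>x\<in>A. \<forall>y\<in>A. x < y \<longrightarrow> y - x \<le> f y - f x)"

text \<open>Points unsuitable for a horizontal arm and points unsuitable for a vertical arm have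
  area at most \<open>2 * d * n\<close> each. Any other point \<open>(a, b)\<close> of
  \<open>T\<close> is the centre of a cross, with \<open>f 0 = a\<close> and
  \<open>g 0 = b\<close>.\<close>

lemma cross_in_thick_planar_set:
  assumes T: "open T" "T \<subseteq> {0..n} \<times> {0..n}" and "d > 0" "n \<ge> 0"
    and thick: "ennreal (4 * d * n) < emeasure lborel T"
  obtains f g where "expanding_on {-d..d} f" "expanding_on {-d..d} g"
    "\<And>s. s \<in> {-d..d} \<Longrightarrow> (f s, g 0) \<in> T" "\<And>s. s \<in> {-d..d} \<Longrightarrow> (f 0, g s) \<in> T"
proof -
  define T' where "T' = prod.swap -` T"
  have T': "open T'" "T' \<subseteq> {0..n} \<times> {0..n}"
    using T continuous_open_vimage[of T prod.swap] unfolding T'_def prod.swap_def[abs_def]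
    by (auto intro!: continuous_intros)
  note rows = emeasure_short_row[OF T \<open>d > 0\<close> \<open>n \<ge> 0\<close>] and cols = emeasure_short_row[OF T' \<open>d > 0\<close> \<open>n \<ge> 0\<close>]
  let ?C = "prod.swap -` short_row d T'"
  have "prod.swap \<in> borel_measurable (borel :: (real \<times> real) measure)"
    unfolding prod.swap_def[abs_def] by (intro borel_measurable_continuous_onI continuous_intros)
  from measurable_sets[OF this cols(1)] have Cm: "?C \<in> sets borel"
    by simp
  have "\<not> T \<subseteq> short_row d T \<union> ?C"
  proof
    assume "T \<subseteq> short_row d T \<union> ?C"
    then have "emeasure lborel T \<le> emeasure lborel (short_row d T \<union> ?C)"
      using rows(1) Cm by (intro emeasure_mono) auto
    also have "\<dots> \<le> emeasure lborel (short_row d T) + emeasure lborel ?C"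
      using rows(1) Cm by (intro emeasure_subadditive) auto
    also have "\<dots> \<le> ennreal (2 * d * n) + ennreal (2 * d * n)"
      using rows(2) cols by (intro add_mono) (auto simp: emeasure_lborel_swap)
    also have "\<dots> = ennreal (4 * d * n)"
      using \<open>d > 0\<close> \<open>n \<ge> 0\<close> by (simp flip: ennreal_plus)
    finally show False using thick by simp
  qed
  then obtain p where "p \<in> T" "p \<notin> short_row d T" "p \<notin> ?C"
    by blast
  then obtain a b where ab: "(a, b) \<in> T" "(a, b) \<notin> short_row d T" "(b, a) \<notin> short_row d T'"
    by (cases p) auto
  define U where "U = {x. (x, b) \<in> T}"
  define V where "V = {y. (a, y) \<in> T}"
  have V: "V = {y. (y, a) \<in> T'}"
    by (simp add: V_def T'_def)
  have U_open: "open U" and V_open: "open V"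
    using row_open[OF T(1)] row_open[OF T'(1)] by (simp_all add: U_def V)
  have bdd: "bounded U" "bounded V"
    using T(2) by (auto simp: U_def V_def intro!: bounded_subset[OF bounded_closed_interval[of 0 n]])
  have "ennreal d < emeasure lborel (U \<inter> {..<a})" "ennreal d < emeasure lborel (U \<inter> {a<..})"
    using ab by (auto simp: short_row_def U_def not_le)
  then obtain f where f: "f 0 = a" "\<And>s. s \<in> {-d..d} \<Longrightarrow> f s \<in> U"
    "\<And>s s'. -d \<le> s \<Longrightarrow> s < s' \<Longrightarrow> s' \<le> d \<Longrightarrow> s' - s \<le> f s' - f s"
    using expanding_into_open[OF U_open bdd(1) _ \<open>d > 0\<close>, of a] ab(1) unfolding U_def by auto
  have "(b, a) \<in> T'" using ab(1) by (simp add: T'_def)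
  with ab(3) have "ennreal d < emeasure lborel (V \<inter> {..<b})" "ennreal d < emeasure lborel (V \<inter> {b<..})"
    by (auto simp: short_row_def V not_le)
  then obtain g where g: "g 0 = b" "\<And>s. s \<in> {-d..d} \<Longrightarrow> g s \<in> V"
    "\<And>s s'. -d \<le> s \<Longrightarrow> s < s' \<Longrightarrow> s' \<le> d \<Longrightarrow> s' - s \<le> g s' - g s"
    using expanding_into_open[OF V_open bdd(2) _ \<open>d > 0\<close>, of b] ab(1) unfolding V_def by auto
  show thesis
  proof (rule that)
    show "expanding_on {-d..d} f" "expanding_on {-d..d} g"
      using f(3) g(3) by (simp_all add: expanding_on_def)
    show "(f s, g 0) \<in> T" "(f 0, g s) \<in> T" if "s \<in> {-d..d}" for s
      using f(1,2) g(1,2) that by (auto simp: U_def V_def)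
  qed
qed

section \<open>Slicing subsets of three-dimensional space\<close>

text \<open>If \<open>w\<close> exceeds the threshold \<open>a\<close>, then
  \<open>w * a ^ (t - 1) \<le> w ^ t\<close>, and \<open>(w / t) ^ t\<close> is at most
  \<open>w choose t\<close>. This linearised bound takes the place of convexity in the
  Kovari-Sos-Turan count; \<open>a\<close> is optimised later.\<close>

lemma nat_le_binomial_bound:
  fixes a :: real
  assumes "t \<ge> 1" "a \<ge> real t"
  shows "real w \<le> a + real t ^ t / a ^ (t - 1) * real (w choose t)"
proof (cases "real w \<le> a")
  case True
  then show ?thesis
    using assms by (smt (verit) divide_nonneg_nonneg mult_nonneg_nonneg of_nat_0_le_iff zero_le_power)
next
  case False
  have a: "a > 0" using assms by linarith
  have "t \<le> w" using False assms by linarith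
  have "a ^ (t - 1) \<le> real w ^ (t - 1)"
    using False a by (intro power_mono) auto
  then have "real w * a ^ (t - 1) \<le> real w * real w ^ (t - 1)"
    by (rule mult_left_mono) simp
  also have "\<dots> = real w ^ t"
    using assms(1) by (simp add: power_eq_if)
  also have "\<dots> = real t ^ t * (real w / real t) ^ t"
    using assms(1) by (simp add: power_divide)
  also have "\<dots> \<le> real t ^ t * real (w choose t)"
    using binomial_ge_n_over_k_pow_k[OF \<open>t \<le> w\<close>, where ?'a = real] by (intro mult_left_mono) auto
  finally have "real w \<le> real t ^ t / a ^ (t - 1) * real (w choose t)"
    using a by (simp add: field_simps)
  then show ?thesis using a by simp
qed

text \<open>For a point in exactly w of the sets, \<open>w choose t\<close> counts the t-fold
  intersections containing it. The previous bound is applied at every point of \<open>R\<close> and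
  integrated.\<close>

lemma sum_emeasure_le_of_intersections:
  fixes T :: "nat \<Rightarrow> 'a set" and a A m :: real
  assumes t: "t \<ge> 1" "a \<ge> real t" and "A \<ge> 0" "m \<ge> 0"
    and R: "R \<in> sets M" "emeasure M R \<le> ennreal A"
    and T: "\<And>j. T j \<in> sets M" "\<And>j. T j \<subseteq> R"
    and int: "\<And>J. J \<subseteq> {..<N} \<Longrightarrow> card J = t \<Longrightarrow> emeasure M (\<Inter>j\<in>J. T j) \<le> ennreal m"
  shows "(\<Sum>j<N. emeasure M (T j)) \<le> ennreal (a * A + real t ^ t / a ^ (t - 1) * real (N choose t) * m)"
proof -
  define P where "P = {J. J \<subseteq> {..<N} \<and> card J = t}"
  define K where "K = real t ^ t / a ^ (t - 1)"
  have a: "a > 0" using t by linarith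
  have K: "K \<ge> 0" using a by (simp add: K_def)
  have finP: "finite P" unfolding P_def by simp
  have cP: "card P = (N choose t)"
    using n_subsets[of "{..<N}" t] by (simp add: P_def)
  have I: "(\<Inter>j\<in>J. T j) \<in> sets M" if "J \<in> P" for J
  proof -
    have "finite J" "J \<noteq> {}"
      using that t(1) finite_subset[of J "{..<N}"] by (auto simp: P_def)
    then show ?thesis using T(1) by (intro sets.finite_INT) auto
  qed
  have pw: "(\<Sum>j<N. indicator (T j) p) \<le> ennreal a * indicator R p + ennreal K * (\<Sum>J\<in>P. indicator (\<Inter>j\<in>J. T j) p)" (is "?l \<le> ?r") for p
  proof (cases "p \<in> R")
    case False
    then have "?l = 0" using T(2) by (intro sum.neutral) (auto simp: indicator_def)
    then show ?thesis by simp
  next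
    case True
    define W where "W = {j. j < N \<and> p \<in> T j}"
    have "?l = of_nat (card W)"
    proof -
      have "{..<N} \<inter> {j. p \<in> T j} = W" by (auto simp: W_def)
      then show ?thesis by (simp add: indicator_def sum.If_cases)
    qed
    moreover have "(\<Sum>J\<in>P. indicator (\<Inter>j\<in>J. T j) p) = (of_nat (card W choose t) :: ennreal)"
    proof -
      have "P \<inter> {J. p \<in> (\<Inter>j\<in>J. T j)} = {J. J \<subseteq> W \<and> card J = t}"
        by (auto simp: P_def W_def)
      moreover have "card {J. J \<subseteq> W \<and> card J = t} = card W choose t"
        by (rule n_subsets) (simp add: W_def)
      ultimately show ?thesis using finP by (simp add: indicator_def sum.If_cases)
    qed
    moreover have "(of_nat (card W) :: ennreal) \<le> ennreal a + ennreal K * of_nat (card W choose t)"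
    proof -
      have "ennreal (real (card W)) \<le> ennreal (a + K * real (card W choose t))"
        using nat_le_binomial_bound[OF t] by (intro ennreal_leI) (simp add: K_def)
      then show ?thesis
        using a K by (simp add: ennreal_plus ennreal_mult' ennreal_of_nat_eq_real_of_nat)
    qed
    ultimately show ?thesis using True by simp
  qed
  have "(\<Sum>j<N. emeasure M (T j)) = (\<integral>\<^sup>+p. (\<Sum>j<N. indicator (T j) p) \<partial>M)"
    using T(1) by (subst nn_integral_sum) auto
  also have "\<dots> \<le> (\<integral>\<^sup>+p. ennreal a * indicator R p + ennreal K * (\<Sum>J\<in>P. indicator (\<Inter>j\<in>J. T j) p) \<partial>M)"
    using pw by (intro nn_integral_mono) auto
  also have "\<dots> = ennreal a * emeasure M R + ennreal K * (\<Sum>J\<in>P. emeasure M (\<Inter>j\<in>J. T j))"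
    using R(1) I by (simp add: nn_integral_add nn_integral_cmult nn_integral_sum borel_measurable_indicator)
  also have "\<dots> \<le> ennreal a * ennreal A + ennreal K * (\<Sum>J\<in>P. ennreal m)"
    using R(2) int by (intro add_mono mult_left_mono sum_mono) (auto simp: P_def)
  also have "\<dots> = ennreal (a * A + K * (real (N choose t) * m))"
    using a K assms(3,4) by (simp add: cP ennreal_plus ennreal_mult ennreal_of_nat_eq_real_of_nat)
  finally show ?thesis by (simp add: K_def mult.assoc)
qed

section \<open>Fubini in three-dimensional space along horizontal slices\<close>

lemma vector_3_axis:
  "(vector [a, b, c] :: real ^ 3) = a *\<^sub>R axis 1 1 + b *\<^sub>R axis 2 1 + c *\<^sub>R axis 3 1"
  by (simp add: vec_eq_iff forall_3 axis_def)

lemma continuous_on_vector_3 [continuous_intros]: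
  assumes "continuous_on A f" "continuous_on A g" "continuous_on A h"
  shows "continuous_on A (\<lambda>x. vector [f x, g x, h x] :: real ^ 3)"
  unfolding vector_3_axis using assms by (intro continuous_intros)

lemma prod_Basis_vec_3:
  fixes v :: "real ^ 3"
  shows "(\<Prod>b\<in>Basis. v \<bullet> b) = v $ 1 * v $ 2 * v $ 3"
proof -
  have B: "Basis = range (\<lambda>i. axis i 1 :: real ^ 3)"
    by (auto simp: Basis_vec_def)
  have "inj (\<lambda>i. axis i 1 :: real ^ 3)"
    by (auto simp: inj_on_def axis_eq_axis)
  then have "(\<Prod>b\<in>Basis. v \<bullet> b) = (\<Prod>i\<in>UNIV. v \<bullet> axis i 1)"
    by (simp only: B prod.reindex o_def)
  also have "\<dots> = v $ 1 * v $ 2 * v $ 3"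
    unfolding UNIV_3 by (simp add: inner_axis)
  finally show ?thesis .
qed

text \<open>Identifies \<open>real ^ 3\<close> with an iterated product, where Fubini for pairs
  applies; it suffices to compare volumes of boxes.\<close>

lemma lborel_vec_3:
  "lborel = distr (lborel :: ((real \<times> real) \<times> real) measure) borel (\<lambda>q. vector [fst (fst q), snd (fst q), snd q] :: real ^ 3)"
    (is "_ = distr _ _ ?h")
proof (rule lborel_eqI)
  fix l u :: "real ^ 3" assume le: "\<And>b. b \<in> Basis \<Longrightarrow> l \<bullet> b \<le> u \<bullet> b"
  have le3: "l $ i \<le> u $ i" for i
    using le[of "axis i 1"] by (simp add: inner_axis)
  have h: "?h \<in> borel_measurable lborel"
    by (simp, intro borel_measurable_continuous_onI continuous_intros)
  have vim: "?h -` box l u = ({l$1<..<u$1} \<times> {l$2<..<u$2}) \<times> {l$3<..<u$3}"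
    by (auto simp: mem_box_cart forall_3)
  have "emeasure (distr lborel borel ?h) (box l u) = emeasure lborel (?h -` box l u)"
    using h by (subst emeasure_distr) auto
  also have "\<dots> = emeasure ((lborel \<Otimes>\<^sub>M lborel) \<Otimes>\<^sub>M lborel) (({l$1<..<u$1} \<times> {l$2<..<u$2}) \<times> {l$3<..<u$3})"
    unfolding vim by (simp add: lborel_prod)
  also have "\<dots> = ennreal (u$1 - l$1) * ennreal (u$2 - l$2) * ennreal (u$3 - l$3)"
    using le3 by (simp add: lborel.emeasure_pair_measure_Times)
  also have "\<dots> = ennreal (\<Prod>b\<in>Basis. (u - l) \<bullet> b)"
    using le3 by (simp add: prod_Basis_vec_3 ennreal_mult)
  finally show "emeasure (distr lborel borel ?h) (box l u) = (\<Prod>b\<in>Basis. (u - l) \<bullet> b)" .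
qed simp

definition slice :: "(real ^ 3) set \<Rightarrow> real \<Rightarrow> (real \<times> real) set" where
  "slice S z = {p. vector [fst p, snd p, z] \<in> S}"

lemma open_slice: "open S \<Longrightarrow> open (slice S z)"
  unfolding slice_def vimage_def[symmetric] by (intro open_vimage continuous_intros)

lemma emeasure_slices:
  assumes "open S"
  shows "(\<lambda>z. emeasure lborel (slice S z)) \<in> borel_measurable borel"
    "emeasure lborel S = (\<integral>\<^sup>+z. emeasure lborel (slice S z) \<partial>lborel)"
proof -
  define h :: "(real \<times> real) \<times> real \<Rightarrow> real ^ 3" where "h q = vector [fst (fst q), snd (fst q), snd q]" for q
  have cont: "continuous_on UNIV h"
    unfolding h_def by (intro continuous_intros)
  then have "open (h -` S)"
    using assms continuous_open_vimage by (auto simp: open_vimage)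
  then have m: "h -` S \<in> sets (lborel \<Otimes>\<^sub>M lborel)"
    by (simp add: lborel_prod cong del: sets_pair_measure_cong)
  have sl: "(\<lambda>p. (p, z)) -` (h -` S) = slice S z" for z
    by (auto simp: h_def slice_def)
  show "(\<lambda>z. emeasure lborel (slice S z)) \<in> borel_measurable borel"
    using lborel_pair.measurable_emeasure_Pair2[OF m] by (simp add: sl)
  have "emeasure lborel S = emeasure (distr lborel borel h) S"
    using lborel_vec_3 by (simp add: h_def[abs_def])
  also have "\<dots> = emeasure (lborel \<Otimes>\<^sub>M lborel) (h -` S)"
    using assms cont by (subst emeasure_distr) (auto simp: lborel_prod borel_measurable_continuous_onI)
  also have "\<dots> = (\<integral>\<^sup>+z. emeasure lborel (slice S z) \<partial>lborel)"
    using m by (simp add: lborel_pair.emeasure_pair_measure_alt2 sl)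
  finally show "emeasure lborel S = (\<integral>\<^sup>+z. emeasure lborel (slice S z) \<partial>lborel)" .
qed

text \<open>The line is cut into blocks of length \<open>c\<close>, and
  \<open>z = (j + u) * c\<close> is substituted in the j-th block. Summing under the integral
  leaves, for each offset \<open>u\<close>, a sum over heights in arithmetic progression with gap
  \<open>c\<close>.\<close>

lemma nn_integral_blocks:
  fixes \<phi> :: "real \<Rightarrow> ennreal"
  assumes [measurable]: "\<phi> \<in> borel_measurable borel" and "c > 0"
    and supp: "\<And>z. z \<notin> {0..<real N * c} \<Longrightarrow> \<phi> z = 0"
    and B: "\<And>u. 0 \<le> u \<Longrightarrow> u < 1 \<Longrightarrow> (\<Sum>j<N. \<phi> ((real j + u) * c)) \<le> B"
  shows "(\<integral>\<^sup>+z. \<phi> z \<partial>lborel) \<le> ennreal c * B"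
proof -
  have "\<phi> z = (\<Sum>j<N. \<phi> z * indicator {real j * c..<real (Suc j) * c} z)" for z
  proof (cases "z \<in> {0..<real N * c}")
    case False
    then show ?thesis by (simp add: supp)
  next
    case True
    define k where "k = nat \<lfloor>z / c\<rfloor>"
    have zc: "0 \<le> z / c" "z / c < real N"
      using True \<open>c > 0\<close> by (auto simp: field_simps)
    have k: "z \<in> {real j * c..<real (Suc j) * c} \<longleftrightarrow> j = k" for j
    proof -
      have "z \<in> {real j * c..<real (Suc j) * c} \<longleftrightarrow> real j \<le> z / c \<and> z / c < real j + 1"
        using \<open>c > 0\<close> by (auto simp: field_simps)
      also have "\<dots> \<longleftrightarrow> \<lfloor>z / c\<rfloor> = int j"
        by (simp add: floor_eq_iff)
      also have "\<dots> \<longleftrightarrow> j = k"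
        using zc(1) by (auto simp: k_def)
      finally show ?thesis .
    qed
    have "k < N"
      using zc unfolding k_def by linarith
    have "(\<Sum>j<N. \<phi> z * indicator {real j * c..<real (Suc j) * c} z) = (\<Sum>j<N. if j = k then \<phi> z else 0)"
      using k by (intro sum.cong) (auto simp: indicator_def)
    then show ?thesis using \<open>k < N\<close> by simp
  qed
  then have "(\<integral>\<^sup>+z. \<phi> z \<partial>lborel) = (\<integral>\<^sup>+z. (\<Sum>j<N. \<phi> z * indicator {real j * c..<real (Suc j) * c} z) \<partial>lborel)"
    by simp
  also have "\<dots> = (\<Sum>j<N. \<integral>\<^sup>+z. \<phi> z * indicator {real j * c..<real (Suc j) * c} z \<partial>lborel)"
    by (rule nn_integral_sum) measurable
  also have "\<dots> = (\<Sum>j<N. ennreal c * (\<integral>\<^sup>+u. \<phi> ((real j + u) * c) * indicator {0..<1} u \<partial>lborel))"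
  proof (rule sum.cong[OF refl])
    fix j
    have mem: "(real j * c + c * u \<in> {real j * c..<real (Suc j) * c}) = (u \<in> {0..<1})" for u
      using \<open>c > 0\<close> by (auto simp: algebra_simps zero_le_mult_iff)
    have "(\<integral>\<^sup>+z. \<phi> z * indicator {real j * c..<real (Suc j) * c} z \<partial>lborel)
      = ennreal \<bar>c\<bar> * (\<integral>\<^sup>+u. \<phi> (real j * c + c * u) * indicator {real j * c..<real (Suc j) * c} (real j * c + c * u) \<partial>lborel)"
      using \<open>c > 0\<close> by (intro nn_integral_real_affine) auto
    also have "(\<lambda>u. \<phi> (real j * c + c * u) * indicator {real j * c..<real (Suc j) * c} (real j * c + c * u))
        = (\<lambda>u. \<phi> ((real j + u) * c) * indicator {0..<1} u)"
      unfolding indicator_def mem by (simp add: algebra_simps)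
    finally show "(\<integral>\<^sup>+z. \<phi> z * indicator {real j * c..<real (Suc j) * c} z \<partial>lborel)
        = ennreal c * (\<integral>\<^sup>+u. \<phi> ((real j + u) * c) * indicator {0..<1} u \<partial>lborel)"
      using \<open>c > 0\<close> by simp
  qed
  also have "\<dots> = ennreal c * (\<integral>\<^sup>+u. (\<Sum>j<N. \<phi> ((real j + u) * c) * indicator {0..<1} u) \<partial>lborel)"
    by (subst nn_integral_sum) (auto simp: sum_distrib_left)
  also have "\<dots> \<le> ennreal c * (\<integral>\<^sup>+u. B * indicator {0..<1::real} u \<partial>lborel)"
  proof -
    have "(\<Sum>j<N. \<phi> ((real j + u) * c) * indicator {0..<1} u) \<le> B * indicator {0..<1} u" for u :: real
      using B[of u] by (cases "u \<in> {0..<1}") auto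
    then show ?thesis
      by (intro mult_left_mono nn_integral_mono) simp_all
  qed
  also have "\<dots> = ennreal c * B"
    by (subst nn_integral_cmult_indicator) auto
  finally show ?thesis .
qed

section \<open>Bounds for the extremal function\<close>

lemma mem_Q_cross_iff:
  "v \<in> Q (cross d) t c \<longleftrightarrow> \<bar>v $ 1\<bar> \<le> d \<and> \<bar>v $ 2\<bar> \<le> d \<and> (v $ 1 = 0 \<or> v $ 2 = 0) \<and>
     (\<exists>k\<in>{1..t}. v $ 3 = real k * c)" (is "?L \<longleftrightarrow> ?R")
proof
  assume ?L then show ?R
    by (auto simp: Q_def cross_def)
next
  assume R: ?R
  then obtain k where k: "k \<in> {1..t}" "v $ 3 = real k * c" by blast
  have "v = vector [(vector [v $ 1, v $ 2] :: real ^ 2) $ 1, (vector [v $ 1, v $ 2] :: real ^ 2) $ 2, real k * c]"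
    using k(2) by (simp add: vec_eq_iff forall_3)
  moreover have "(vector [v $ 1, v $ 2] :: real ^ 2) \<in> cross d"
    using R by (simp add: cross_def)
  ultimately show ?L
    using k(1) unfolding Q_def by blast
qed

lemma contains_Q_crossI:
  assumes "c > 0" and f: "expanding_on {-d..d} f" and g: "expanding_on {-d..d} g"
    and h: "\<And>k l. k \<in> {1..t} \<Longrightarrow> l \<in> {1..t} \<Longrightarrow> k < l \<Longrightarrow> real (l - k) * c \<le> h l - h k"
    and mem: "\<And>s k. s \<in> {-d..d} \<Longrightarrow> k \<in> {1..t} \<Longrightarrow> vector [f s, g 0, h k] \<in> S"
      "\<And>s k. s \<in> {-d..d} \<Longrightarrow> k \<in> {1..t} \<Longrightarrow> vector [f 0, g s, h k] \<in> S"
  shows "contains S (Q (cross d) t c)"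
proof -
  \<comment> \<open>The third map has to be defined on reals; the floor of \<open>x / c\<close>
    recovers the index \<open>k\<close> from the height \<open>k * c\<close>.\<close>
  define F :: "3 \<Rightarrow> real \<Rightarrow> real" where
    "F i = (if i = 1 then f else if i = 2 then g else (\<lambda>x. h (nat \<lfloor>x / c\<rfloor>)))" for i
  have F3: "F 3 (real k * c) = h k" for k
    using \<open>c > 0\<close> by (simp add: F_def)
  have FS: "(\<chi> i. F i (v $ i)) \<in> S" if v: "v \<in> Q (cross d) t c" for v
  proof -
    obtain k where k: "k \<in> {1..t}" "v $ 3 = real k * c"
      using v by (auto simp: mem_Q_cross_iff)
    have "(\<chi> i. F i (v $ i)) = vector [f (v $ 1), g (v $ 2), h k]"
      using F3[of k] k(2) by (simp add: vec_eq_iff forall_3) (simp add: F_def)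
    moreover have "v $ 1 \<in> {-d..d}" "v $ 2 \<in> {-d..d}" "v $ 1 = 0 \<or> v $ 2 = 0"
      using v by (auto simp: mem_Q_cross_iff)
    ultimately show ?thesis
      using mem k(1) by auto
  qed
  have exp: "x - x' \<le> F i x - F i x'"
    if asm: "x \<in> coords i (Q (cross d) t c)" "x' \<in> coords i (Q (cross d) t c)" "x > x'" for i x x'
  proof -
    consider "i = 1" | "i = 2" | "i = 3" using exhaust_3 by blast
    then show ?thesis
    proof cases
      case 1
      have "x \<in> {-d..d}" "x' \<in> {-d..d}"
        using asm(1,2) unfolding 1 by (auto simp: coords_def mem_Q_cross_iff)
      with f asm(3) show ?thesis by (simp add: 1 F_def expanding_on_def)
    next
      case 2
      have "x \<in> {-d..d}" "x' \<in> {-d..d}"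
        using asm(1,2) unfolding 2 by (auto simp: coords_def mem_Q_cross_iff)
      with g asm(3) show ?thesis by (simp add: 2 F_def expanding_on_def)
    next
      case 3
      obtain k l where kl: "k \<in> {1..t}" "x' = real k * c" "l \<in> {1..t}" "x = real l * c"
        using asm(1,2) unfolding 3 coords_def by (auto simp: mem_Q_cross_iff)
      with asm(3) \<open>c > 0\<close> have "k < l" by simp
      then have "x - x' = real (l - k) * c"
        using kl by (simp add: of_nat_diff algebra_simps)
      also have "\<dots> \<le> h l - h k" using h kl \<open>k < l\<close> by blast
      finally show ?thesis using kl F3 by (simp add: 3)
    qed
  qed
  show ?thesis
    unfolding contains_def
  proof (intro exI[of _ F] conjI allI ballI impI)
    fix i show "F i \<in> coords i (Q (cross d) t c) \<rightarrow> coords i S"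
    proof
      fix x assume "x \<in> coords i (Q (cross d) t c)"
      then obtain v where v: "v \<in> Q (cross d) t c" "x = v $ i"
        by (auto simp: coords_def)
      then have "F i x = (\<chi> i. F i (v $ i)) $ i" by simp
      then show "F i x \<in> coords i S"
        unfolding coords_def using FS[OF v(1)] by (rule image_eqI)
    qed
  next
    fix i x x'
    assume "x \<in> coords i (Q (cross d) t c)" "x' \<in> coords i (Q (cross d) t c)" "x > x'"
    with exp[OF this] show "(F i x - F i x') / (x - x') \<ge> 1" by simp
  next
    fix v assume "v \<in> Q (cross d) t c"
    then show "(\<chi> i. F i (v $ i)) \<in> S" by (rule FS)
  qed
qed

lemma enumerate_diff_ge:
  assumes "finite J" "k \<le> l" "l < card J"
  shows "enumerate J k + (l - k) \<le> enumerate J l"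
  using assms(2,3)
proof (induction l rule: dec_induct)
  case (step l)
  then have "enumerate J l < enumerate J (Suc l)"
    using finite_enumerate_step[OF assms(1)] by simp
  with step show ?case by simp
qed simp

lemma slice_subset:
  assumes "S \<subseteq> cbox 0 (\<chi> i. n)"
  shows "slice S z \<subseteq> {0..n} \<times> {0..n}" and "z \<notin> {0..n} \<Longrightarrow> slice S z = {}"
  using assms by (auto simp: slice_def mem_box_cart forall_3 subset_eq)

text \<open>A larger intersection contains a cross, which then lies in \<open>S\<close> at all
  heights \<open>(j + u) * c\<close> with \<open>j\<close> in \<open>J\<close>. These
  \<open>t\<close> heights are at least \<open>c\<close> apart, so they can receive the heights of
  the pattern.\<close>

lemma emeasure_Inter_slices:
  assumes S: "open S" "S \<subseteq> cbox 0 (\<chi> i. n)" "pattern_free (Q (cross d) t c) S"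
    and "d > 0" "c > 0" "n \<ge> 0" "finite J" "card J = t" "t \<ge> 1"
  shows "emeasure lborel (\<Inter>j\<in>J. slice S ((real j + u) * c)) \<le> ennreal (4 * d * n)"
proof (rule ccontr)
  let ?T = "\<Inter>j\<in>J. slice S ((real j + u) * c)"
  assume "\<not> emeasure lborel ?T \<le> ennreal (4 * d * n)"
  then have thick: "ennreal (4 * d * n) < emeasure lborel ?T" by simp
  have J: "J \<noteq> {}" using assms by auto
  have "open ?T"
    using \<open>finite J\<close> S(1) open_slice by (intro open_INT) auto
  moreover have "?T \<subseteq> {0..n} \<times> {0..n}"
    using J slice_subset(1)[OF S(2)] by fast
  ultimately obtain f g where fg: "expanding_on {-d..d} f" "expanding_on {-d..d} g"
    and T: "\<And>s. s \<in> {-d..d} \<Longrightarrow> (f s, g 0) \<in> ?T" "\<And>s. s \<in> {-d..d} \<Longrightarrow> (f 0, g s) \<in> ?T"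
    using cross_in_thick_planar_set[OF _ _ \<open>d > 0\<close> \<open>n \<ge> 0\<close> thick] by metis
  \<comment> \<open>The heights in increasing order. Levels of the pattern are numbered from 1 and
    \<open>enumerate\<close> from 0, hence \<open>k - 1\<close>.\<close>
  define h where "h k = (real (enumerate J (k - 1)) + u) * c" for k
  have "contains S (Q (cross d) t c)"
  proof (rule contains_Q_crossI[OF \<open>c > 0\<close> fg])
    fix k l assume kl: "k \<in> {1..t}" "l \<in> {1..t}" "k < l"
    then have "enumerate J (k - 1) + (l - 1 - (k - 1)) \<le> enumerate J (l - 1)"
      using assms by (intro enumerate_diff_ge) auto
    then have "real (l - k) \<le> real (enumerate J (l - 1)) - real (enumerate J (k - 1))"
      using kl by auto
    then have "real (l - k) * c \<le> (real (enumerate J (l - 1)) - real (enumerate J (k - 1))) * c"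
      using \<open>c > 0\<close> by (intro mult_right_mono) auto
    then show "real (l - k) * c \<le> h l - h k"
      by (simp add: h_def algebra_simps)
  next
    have hJ: "p \<in> slice S (h k)" if "p \<in> ?T" "k \<in> {1..t}" for p k
    proof -
      have "enumerate J (k - 1) \<in> J"
        using that(2) assms by (intro finite_enumerate_in_set) auto
      then show ?thesis using that(1) unfolding h_def by blast
    qed
    show "vector [f s, g 0, h k] \<in> S" "vector [f 0, g s, h k] \<in> S"
      if "s \<in> {-d..d}" "k \<in> {1..t}" for s k
      using hJ[OF T(1)[OF that(1)] that(2)] hJ[OF T(2)[OF that(1)] that(2)] by (simp_all add: slice_def)
  qed
  with S(3) show False by (simp add: pattern_free_def)
qed

text \<open>For every offset the N slices satisfy the double count with the square as
  \<open>R\<close> and \<open>4 * d * n\<close> as the bound for intersections; integrating over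
  offsets contributes the factor \<open>c\<close>.\<close>

lemma emeasure_pattern_free_le:
  assumes S: "open S" "S \<subseteq> cbox 0 (\<chi> i. n)" "pattern_free (Q (cross d) t c) S"
    and "d > 0" "c > 0" "n \<ge> 0" "t \<ge> 1" "a \<ge> real t" and N: "n < real N * c"
  shows "emeasure lborel S \<le> ennreal (c * (a * n\<^sup>2 + real t ^ t / a ^ (t - 1) * real (N choose t) * (4 * d * n)))"
proof -
  let ?\<phi> = "\<lambda>z. emeasure lborel (slice S z)"
  define B where "B = a * n\<^sup>2 + real t ^ t / a ^ (t - 1) * real (N choose t) * (4 * d * n)"
  have "emeasure lborel S = (\<integral>\<^sup>+z. ?\<phi> z \<partial>lborel)"
    by (rule emeasure_slices(2)[OF S(1)])
  also have "\<dots> \<le> ennreal c * ennreal B"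
  proof (rule nn_integral_blocks[OF emeasure_slices(1)[OF S(1)] \<open>c > 0\<close>, of N])
    fix z assume "z \<notin> {0..<real N * c}"
    then have "z \<notin> {0..n}" using N by auto
    then show "?\<phi> z = 0" using slice_subset(2)[OF S(2)] by simp
  next
    fix u :: real
    have "emeasure lborel ({0..n} \<times> {0..n}) = ennreal (n\<^sup>2)"
    proof -
      have "emeasure (lborel \<Otimes>\<^sub>M lborel) ({0..n} \<times> {0..n}) = ennreal n * ennreal n"
        using \<open>n \<ge> 0\<close> by (subst lborel.emeasure_pair_measure_Times) auto
      then show ?thesis
        using \<open>n \<ge> 0\<close> by (simp add: lborel_prod power2_eq_square ennreal_mult)
    qed
    then show "(\<Sum>j<N. ?\<phi> ((real j + u) * c)) \<le> ennreal B"
      unfolding B_def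
    proof (intro sum_emeasure_le_of_intersections[where R = "{0..n} \<times> {0..n}"])
      show "slice S ((real j + u) * c) \<in> sets lborel" for j
        using open_slice[OF S(1)] by simp
      show "slice S ((real j + u) * c) \<subseteq> {0..n} \<times> {0..n}" for j
        by (rule slice_subset(1)[OF S(2)])
      show "emeasure lborel (\<Inter>j\<in>J. slice S ((real j + u) * c)) \<le> ennreal (4 * d * n)"
        if "J \<subseteq> {..<N}" "card J = t" for J
        using that finite_subset[of J "{..<N}"] assms by (intro emeasure_Inter_slices) auto
    qed (use assms in \<open>auto simp: borel_closed closed_Times\<close>)
  qed
  also have "\<dots> = ennreal (c * B)"
    using \<open>c > 0\<close> by (simp add: ennreal_mult')
  finally show ?thesis by (simp add: B_def)
qed

lemma pattern_free_empty:
  assumes "d > 0" "t \<ge> 1"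
  shows "pattern_free (Q (cross d) t c) {}"
proof -
  have "vector [0, 0, real 1 * c] \<in> Q (cross d) t c"
    unfolding mem_Q_cross_iff using assms by (auto intro!: bexI[of _ 1])
  then show ?thesis
    unfolding pattern_free_def contains_def by blast
qed

lemma opx_le:
  assumes "d > 0" "t \<ge> 1"
    and "\<And>S. open S \<Longrightarrow> S \<subseteq> cbox 0 (\<chi> i. n) \<Longrightarrow> pattern_free (Q (cross d) t c) S \<Longrightarrow> measure lebesgue S \<le> B"
  shows "opx n (Q (cross d) t c) \<le> B"
  unfolding opx_def
proof (rule cSUP_least)
  have "{} \<in> {S. open S \<and> S \<subseteq> cbox 0 (\<chi> i. n) \<and> pattern_free (Q (cross d) t c) S}"
    using pattern_free_empty[OF assms(1,2)] by simp
  then show "{S. open S \<and> S \<subseteq> cbox 0 (\<chi> i. n) \<and> pattern_free (Q (cross d) t c) S} \<noteq> {}"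
    by (metis empty_iff)
qed (use assms(3) in auto)

lemma le_opx:
  fixes P :: "(real ^ 'd::finite) set"
  assumes "open S" "S \<subseteq> cbox 0 (\<chi> i. n)" "pattern_free P S"
  shows "measure lebesgue S \<le> opx n P"
  unfolding opx_def
proof (rule cSUP_upper)
  show "bdd_above (measure lebesgue ` {S. open S \<and> S \<subseteq> cbox 0 (\<chi> i. n) \<and> pattern_free P S})"
  proof (rule bdd_aboveI2)
    fix S assume "S \<in> {S. open S \<and> S \<subseteq> cbox 0 (\<chi> i. n) \<and> pattern_free P S}"
    then show "measure lebesgue S \<le> measure lebesgue (cbox 0 (\<chi> i. n) :: (real ^ 'd) set)"
      by (intro measure_mono_fmeasurable) auto
  qed
qed (use assms in auto)

lemma binomial_le_power: "real (N choose t) \<le> real N ^ t"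
proof (cases "t \<le> N")
  case True
  then show ?thesis
    using binomial_le_pow[of t N] by (metis of_nat_le_iff of_nat_power)
qed (simp add: binomial_eq_0)

lemma opx_upper_bound:
  assumes "d > 0" "c > 0" "t \<ge> 2"
  obtains C where "C > 0" "eventually (\<lambda>n. opx n (Q (cross d) t c) \<le> C * n powr (3 - 1 / real t)) at_top"
proof -
  \<comment> \<open>The threshold \<open>a = n powr \<alpha>\<close> balances the two terms: with N
    of order n, both \<open>a * n^2\<close> and \<open>N^t * n / a^(t - 1)\<close> have order
    \<open>n powr (3 - 1 / t)\<close>.\<close>
  define \<alpha> where "\<alpha> = 1 - 1 / real t"
  have "\<alpha> > 0" using assms(3) by (simp add: \<alpha>_def field_simps)
  \<comment> \<open>The constant of the second term, using \<open>N \<le> 3 * n / c\<close>, which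
    holds once \<open>n \<ge> c\<close>.\<close>
  define K where "K = real t ^ t * (3 / c) ^ t * (4 * d)"
  have K: "K \<ge> 0" using assms by (simp add: K_def)
  have "eventually (\<lambda>n. n powr \<alpha> \<ge> real t) at_top"
    using eventually_ge_at_top[of "real t powr (1 / \<alpha>)"]
  proof eventually_elim
    case (elim n)
    then have "(real t powr (1 / \<alpha>)) powr \<alpha> \<le> n powr \<alpha>"
      using \<open>\<alpha> > 0\<close> by (intro powr_mono2) auto
    then show ?case using \<open>\<alpha> > 0\<close> assms(3) by (simp add: powr_powr)
  qed
  then have "eventually (\<lambda>n. opx n (Q (cross d) t c) \<le> c * (1 + K) * n powr (3 - 1 / real t)) at_top"
    using eventually_ge_at_top[of c] eventually_gt_at_top[of 0]
  proof eventually_elim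
    case (elim n)
    define a where "a = n powr \<alpha>"
    have a: "a \<ge> real t" "a > 0" using elim by (auto simp: a_def)
    have "n / c \<ge> 1" using elim assms(2) by simp
    \<comment> \<open>The extra 1 makes \<open>n < N * c\<close> strict, so that the half-open
      blocks also cover the height n.\<close>
    define N where "N = nat \<lceil>n / c\<rceil> + 1"
    define z where "z = real_of_int \<lceil>n / c\<rceil>"
    have "n / c \<le> z" "z \<le> n / c + 1"
      unfolding z_def by (rule le_of_int_ceiling, rule of_int_ceiling_le_add_one)
    moreover have "real N = z + 1"
      using \<open>n / c \<ge> 1\<close> by (simp add: N_def z_def)
    ultimately have N: "n / c < real N" "real N \<le> n / c + 2"
      by simp_all
    have "n < real N * c"
      using N(1) assms(2) by (simp add: pos_divide_less_eq)
    have "real N \<le> 3 * (n / c)"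
      using N(2) \<open>n / c \<ge> 1\<close> by linarith
    then have "real N \<le> 3 / c * n" by simp
    then have "real N ^ t \<le> (3 / c * n) ^ t"
      by (intro power_mono) auto
    with binomial_le_power[of N t] have "real (N choose t) \<le> (3 / c * n) ^ t"
      by (rule order_trans)
    then have "real t ^ t / a ^ (t - 1) * real (N choose t) * (4 * d * n)
        \<le> real t ^ t / a ^ (t - 1) * (3 / c * n) ^ t * (4 * d * n)"
      using a elim assms by (intro mult_right_mono mult_left_mono) auto
    also have "\<dots> = K * (n ^ t * n / a ^ (t - 1))"
      unfolding K_def power_mult_distrib[of "3 / c" n t] by simp
    also have "n ^ t * n / a ^ (t - 1) = n powr (3 - 1 / real t)"
    proof -
      have "n ^ t * n = n powr (real t + 1)"
        using elim by (simp add: powr_add powr_realpow)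
      moreover have "a ^ (t - 1) = n powr (\<alpha> * (real t - 1))"
        using elim assms(3) by (simp add: a_def powr_powr of_nat_diff flip: powr_realpow)
      moreover have "real t + 1 - \<alpha> * (real t - 1) = 3 - 1 / real t"
        using assms(3) by (simp add: \<alpha>_def field_simps)
      ultimately show ?thesis by (simp only: powr_diff[symmetric])
    qed
    finally have 2: "real t ^ t / a ^ (t - 1) * real (N choose t) * (4 * d * n) \<le> K * n powr (3 - 1 / real t)" .
    have 1: "a * n\<^sup>2 = n powr (3 - 1 / real t)"
    proof -
      have "n\<^sup>2 = n powr 2" using elim by (simp add: powr_numeral)
      then have "a * n\<^sup>2 = n powr (\<alpha> + 2)" by (simp add: a_def powr_add)
      then show ?thesis by (simp add: \<alpha>_def)
    qed
    define B where "B = a * n\<^sup>2 + real t ^ t / a ^ (t - 1) * real (N choose t) * (4 * d * n)"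
    have "B \<ge> 0" using a assms elim by (simp add: B_def)
    have "opx n (Q (cross d) t c) \<le> c * B"
    proof (rule opx_le)
      fix S :: "(real ^ 3) set"
      assume S: "open S" "S \<subseteq> cbox 0 (\<chi> i. n)" "pattern_free (Q (cross d) t c) S"
      have "emeasure lborel S \<le> ennreal (c * B)"
        unfolding B_def using S assms elim a \<open>n < real N * c\<close>
        by (intro emeasure_pattern_free_le) auto
      then have "measure lborel S \<le> c * B"
        using assms(2) \<open>B \<ge> 0\<close> unfolding measure_def by (metis enn2real_leI mult_nonneg_nonneg less_imp_le)
      then show "measure lebesgue S \<le> c * B"
        using S(1) by (simp add: measure_completion)
    qed (use assms in auto)
    also have "\<dots> \<le> c * (n powr (3 - 1 / real t) + K * n powr (3 - 1 / real t))"
      unfolding B_def using 1 2 assms(2) by (intro mult_left_mono add_mono) auto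
    also have "\<dots> = c * (1 + K) * n powr (3 - 1 / real t)"
      by (simp add: algebra_simps)
    finally show ?case .
  qed
  moreover have "c * (1 + K) > 0" using assms(2) K by simp
  ultimately show thesis using that by blast
qed

section \<open>The lower bound\<close>

text \<open>The cells over the edges are disjoint open boxes of volume \<open>d * c * n\<close>. To
  exclude the pattern only its points with second coordinate 0 and first coordinate -d, 0 or d are
  examined: their images would span a biclique in \<open>E\<close>.\<close>

lemma opx_ge_of_biclique_free:
  assumes "d > 0" "c > 0" "n > 0" and E: "biclique_free 3 t E" "E \<subseteq> {..<N} \<times> {..<N}"
    and N: "real N * d \<le> n" "real N * c \<le> n"
  shows "real (card E) * (d * c * n) \<le> opx n (Q (cross d) t c)"
proof -
  define b where "b e = box (vector [real (fst e) * d, 0, real (snd e) * c])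
     (vector [(real (fst e) + 1) * d, n, (real (snd e) + 1) * c] :: real ^ 3)" for e :: "nat \<times> nat"
  define S where "S = (\<Union>e\<in>E. b e)"
  have fin: "finite E" using E(2) finite_subset by blast
  have mem: "v \<in> b (i, k) \<longleftrightarrow> real i * d < v $ 1 \<and> v $ 1 < (real i + 1) * d \<and> 0 < v $ 2 \<and> v $ 2 < n \<and>
      real k * c < v $ 3 \<and> v $ 3 < (real k + 1) * c" for v i k
    by (auto simp: b_def mem_box_cart forall_3)
  have "open S" unfolding S_def b_def by (intro open_UN) auto
  have "S \<subseteq> cbox 0 (\<chi> i. n)"
  proof
    fix v assume "v \<in> S"
    then obtain i k where ik: "(i, k) \<in> E" "v \<in> b (i, k)" by (auto simp: S_def)
    then have "real i + 1 \<le> real N" "real k + 1 \<le> real N" using E(2) by auto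
    then have "(real i + 1) * d \<le> real N * d" "(real k + 1) * c \<le> real N * c"
      using assms(1,2) by (auto intro: mult_right_mono)
    then have le: "v $ 1 \<le> n" "v $ 3 \<le> n" using ik(2) N by (auto simp: mem)
    have "0 \<le> real i * d" "0 \<le> real k * c" using assms(1,2) by auto
    then show "v \<in> cbox 0 (\<chi> i. n)"
      using ik(2) le by (auto simp: mem mem_box_cart forall_3)
  qed
  \<comment> \<open>Two points of one open cell of width \<open>w\<close> are less than
    \<open>w\<close> apart, so an increase by at least \<open>w\<close> leads to a cell of larger
    index.\<close>
  have sep: "i < i'" if "real i * w < x" "x' < (real i' + 1) * w" "x' - x \<ge> w" "w > 0" for i i' :: nat and x x' w :: real
  proof -
    have "x' < real i' * w + w"
      using that(2) by (simp add: distrib_right)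
    then have "real i * w < real i' * w"
      using that by linarith
    then show ?thesis using that(4) by simp
  qed
  have "pattern_free (Q (cross d) t c) S"
    unfolding pattern_free_def
  proof
    assume "contains S (Q (cross d) t c)"
    then obtain F where
      F: "\<And>i x x'. x \<in> coords i (Q (cross d) t c) \<Longrightarrow> x' \<in> coords i (Q (cross d) t c) \<Longrightarrow>
           x > x' \<Longrightarrow> (F i x - F i x') / (x - x') \<ge> 1"
      "\<And>v. v \<in> Q (cross d) t c \<Longrightarrow> (\<chi> i. F i (v $ i)) \<in> S"
      unfolding contains_def by blast
    have v: "vector [x, 0, real k * c] \<in> Q (cross d) t c" if "x \<in> {-d, 0, d}" "k \<in> {1..t}" for x k
      unfolding mem_Q_cross_iff using that \<open>d > 0\<close> by auto
    have exp: "x - x' \<le> F i x - F i x'"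
      if "x \<in> coords i (Q (cross d) t c)" "x' \<in> coords i (Q (cross d) t c)" "x > x'" for i x x'
      using F(1)[OF that] that(3) by simp
    \<comment> \<open>The column hit by the image of \<open>x\<close> and the row hit by the image
      of the k-th level. Since \<open>F\<close> acts coordinatewise, the column depends on
      \<open>x\<close> alone and the row on \<open>k\<close> alone, so every pair of a column and a
      row is an edge.\<close>
    define \<iota> where "\<iota> x = nat \<lfloor>F 1 x / d\<rfloor>" for x
    define \<kappa> where "\<kappa> k = nat \<lfloor>F 3 (real k * c) / c\<rfloor>" for k :: nat
    have cell: "(\<iota> x, \<kappa> k) \<in> E \<and> real (\<iota> x) * d < F 1 x \<and> F 1 x < (real (\<iota> x) + 1) * d \<and>
        real (\<kappa> k) * c < F 3 (real k * c) \<and> F 3 (real k * c) < (real (\<kappa> k) + 1) * c"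
      if asm: "x \<in> {-d, 0, d}" "k \<in> {1..t}" for x k
    proof -
      obtain i j where ij: "(i, j) \<in> E" "(\<chi> i. F i ((vector [x, 0, real k * c] :: real ^ 3) $ i)) \<in> b (i, j)"
        using F(2)[OF v[OF asm]] by (auto simp: S_def)
      then have bd: "real i * d < F 1 x" "F 1 x < (real i + 1) * d"
        "real j * c < F 3 (real k * c)" "F 3 (real k * c) < (real j + 1) * c"
        by (auto simp: mem)
      then have "\<lfloor>F 1 x / d\<rfloor> = int i" "\<lfloor>F 3 (real k * c) / c\<rfloor> = int j"
        using assms(1,2) by (auto simp: floor_eq_iff field_simps)
      then have "\<iota> x = i" "\<kappa> k = j" by (simp_all add: \<iota>_def \<kappa>_def)
      with ij bd show ?thesis by simp
    qed
    show False
    proof (cases "t = 0")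
      \<comment> \<open>For \<open>t = 0\<close> no \<open>E\<close> is biclique-free, since
        \<open>I \<times> {}\<close> is always contained in it.\<close>
      case True
      then show False
        using E(1) unfolding biclique_free_def
        by (metis card.empty card_3_iff Sigma_empty2 empty_subsetI card_lessThan)
    next
      case False
      then have t1: "1 \<in> {1..t}" by auto
      have d3: "x \<in> coords 1 (Q (cross d) t c)" if "x \<in> {-d, 0, d}" for x
        unfolding coords_def using v[OF that t1] by (intro image_eqI[OF _ v[OF that t1]]) simp
      have c3: "real k * c \<in> coords 3 (Q (cross d) t c)" if "k \<in> {1..t}" for k
        unfolding coords_def using that by (intro image_eqI[OF _ v[of 0 k]]) auto
      have "\<iota> (-d) < \<iota> 0" "\<iota> 0 < \<iota> d"
        using cell[OF _ t1, of "-d"] cell[OF _ t1, of 0] cell[OF _ t1, of d]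
          exp[OF d3[of 0] d3[of "-d"]] exp[OF d3[of d] d3[of 0]] \<open>d > 0\<close>
        by (auto intro!: sep[where w = d])
      then have "card {\<iota> (-d), \<iota> 0, \<iota> d} = 3" by auto
      moreover have "card (\<kappa> ` {1..t}) = t"
      proof -
        have "\<kappa> k < \<kappa> l" if "k \<in> {1..t}" "l \<in> {1..t}" "k < l" for k l
        proof (rule sep[where w = c])
          have "c \<le> (real l - real k) * c"
            using that(3) \<open>c > 0\<close> by simp
          also have "\<dots> \<le> F 3 (real l * c) - F 3 (real k * c)"
            using exp[OF c3 c3, of l k] that \<open>c > 0\<close> by (simp add: left_diff_distrib)
          finally show "F 3 (real l * c) - F 3 (real k * c) \<ge> c" .
        qed (use cell[of 0] that \<open>c > 0\<close> in auto)
        then have "inj_on \<kappa> {1..t}"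
          by (intro linorder_inj_onI) (metis less_irrefl, auto)
        then show ?thesis by (simp add: card_image)
      qed
      moreover have "{\<iota> (-d), \<iota> 0, \<iota> d} \<times> \<kappa> ` {1..t} \<subseteq> E"
        using cell by auto
      ultimately show False
        using E(1) unfolding biclique_free_def by blast
    qed
  qed
  with \<open>open S\<close> \<open>S \<subseteq> cbox 0 (\<chi> i. n)\<close> have "measure lebesgue S \<le> opx n (Q (cross d) t c)"
    by (intro le_opx)
  moreover have "measure lebesgue S = real (card E) * (d * c * n)"
  proof -
    have eb: "emeasure lborel (b e) = ennreal (d * c * n)" for e :: "nat \<times> nat"
    proof -
      have "emeasure lborel (b e) = ennreal (\<Prod>x\<in>Basis. (vector [(real (fst e) + 1) * d, n, (real (snd e) + 1) * c]
          - vector [real (fst e) * d, 0, real (snd e) * c] :: real ^ 3) \<bullet> x)"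
        unfolding b_def using assms
        by (intro emeasure_lborel_box) (auto simp: Basis_vec_def inner_axis algebra_simps forall_3 intro: forall_3[THEN iffD2, rule_format])
      also have "\<dots> = ennreal (d * c * n)"
        unfolding prod_Basis_vec_3 by (simp add: algebra_simps)
      finally show ?thesis .
    qed
    have disj: "disjoint_family_on b E"
      unfolding disjoint_family_on_def
    proof (intro ballI impI)
      fix e e' :: "nat \<times> nat" assume "e \<noteq> e'"
      have "e = e'" if "v \<in> b e" "v \<in> b e'" for v
      proof -
        have fl: "\<lfloor>v $ 1 / d\<rfloor> = int i \<and> \<lfloor>v $ 3 / c\<rfloor> = int k" if "v \<in> b (i, k)" for i k
          using that assms(1,2) by (auto simp: mem floor_eq_iff field_simps)
        show ?thesis
          using fl[of "fst e" "snd e"] fl[of "fst e'" "snd e'"] that by (auto simp: prod_eq_iff)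
      qed
      with \<open>e \<noteq> e'\<close> show "b e \<inter> b e' = {}" by blast
    qed
    have "b ` E \<subseteq> sets lborel"
      by (auto simp: b_def)
    then have "emeasure lborel S = (\<Sum>e\<in>E. emeasure lborel (b e))"
      unfolding S_def using fin disj by (intro sum_emeasure[symmetric])
    also have "\<dots> = ennreal (real (card E) * (d * c * n))"
      using assms by (simp add: eb ennreal_mult ennreal_of_nat_eq_real_of_nat)
    finally have "measure lborel S = real (card E) * (d * c * n)"
      using assms by (simp add: measure_def)
    then show ?thesis using \<open>open S\<close> by (simp add: measure_completion)
  qed
  ultimately show ?thesis by simp
qed

text \<open>A grid of \<open>q ^ t\<close> cells per side must fit into the cube, so q should be
  about \<open>y = (n / r) powr (1 / t)\<close>. Rounding down to a power of two loses at most a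
  factor 2 in q, which only affects the constant.\<close>

lemma opx_lower_bound:
  assumes "d > 0" "c > 0" "t \<ge> 1" "\<kappa> > 0"
    and graphs: "\<And>m q. m > 0 \<Longrightarrow> q = 2 ^ m \<Longrightarrow>
      \<exists>E. biclique_free 3 t E \<and> E \<subseteq> {..<q ^ t} \<times> {..<q ^ t} \<and> \<kappa> * real q ^ (2 * t - 1) \<le> real (card E)"
  obtains C where "C > 0" "eventually (\<lambda>n. C * n powr (3 - 1 / real t) \<le> opx n (Q (cross d) t c)) at_top"
proof -
  define r where "r = max c d"
  have r: "r > 0" "c \<le> r" "d \<le> r" using assms by (auto simp: r_def)
  \<comment> \<open>The factor \<open>d * c\<close> comes from the cells, the power of 2 from
    \<open>y \<le> 2 * q\<close>, and the power of \<open>r\<close> from rewriting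
    \<open>y ^ (2 * t - 1)\<close> in terms of n.\<close>
  define C where "C = \<kappa> * d * c / (2 ^ (2 * t - 1) * r powr (2 - 1 / real t))"
  have "C > 0" using assms r by (simp add: C_def)
  have "eventually (\<lambda>n. C * n powr (3 - 1 / real t) \<le> opx n (Q (cross d) t c)) at_top"
    using eventually_ge_at_top[of "2 ^ t * r"]
  proof eventually_elim
    case (elim n)
    have "0 < 2 ^ t * r" using r by simp
    with elim have "n > 0" by linarith
    define y where "y = (n / r) powr (1 / real t)"
    have yt: "y ^ t = n / r"
      using \<open>n > 0\<close> r assms(3) by (simp add: y_def powr_powr flip: powr_realpow)
    \<comment> \<open>The threshold \<open>2 ^ t * r\<close> for n yields \<open>y \<ge> 2\<close>,
      hence an exponent \<open>m > 0\<close> as the graphs require.\<close>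
    have "2 ^ t \<le> y ^ t" using elim r by (simp add: yt field_simps)
    then have "y \<ge> 2"
      using assms(3) by (rule_tac power_le_imp_le_base[of 2 "t - 1" y]) (auto simp: y_def)
    then have k: "nat \<lfloor>y\<rfloor> \<ge> 2" by linarith
    then obtain m where m: "2 ^ m \<le> nat \<lfloor>y\<rfloor>" "nat \<lfloor>y\<rfloor> < 2 ^ (m + 1)"
      using ex_power_ivl1[of 2 "nat \<lfloor>y\<rfloor>"] by auto
    have "m > 0" using k m(2) by (cases m) auto
    define q :: nat where "q = 2 ^ m"
    have q: "real q \<le> y" "y \<le> 2 * real q" 
    proof -
      have "q \<le> nat \<lfloor>y\<rfloor>" "nat \<lfloor>y\<rfloor> + 1 \<le> 2 * q"
        using m by (simp_all add: q_def)
      then show "real q \<le> y" "y \<le> 2 * real q"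
        using k by linarith+
    qed
    obtain E where E: "biclique_free 3 t E" "E \<subseteq> {..<q ^ t} \<times> {..<q ^ t}"
      "\<kappa> * real q ^ (2 * t - 1) \<le> real (card E)"
      using graphs[OF \<open>m > 0\<close> q_def] by blast
    have "real q ^ t \<le> n / r"
      using q(1) unfolding yt[symmetric] by (intro power_mono) auto
    then have "real q ^ t * r \<le> n" using r by (simp add: field_simps)
    moreover have "real q ^ t * c \<le> real q ^ t * r" "real q ^ t * d \<le> real q ^ t * r"
      using r by (auto intro: mult_left_mono)
    ultimately have low: "real (card E) * (d * c * n) \<le> opx n (Q (cross d) t c)"
      using assms \<open>n > 0\<close> E by (intro opx_ge_of_biclique_free[where N = "q ^ t"]) auto
    have "y ^ (2 * t - 1) = (n / r) powr (2 - 1 / real t)"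
    proof -
      have "y > 0" using \<open>y \<ge> 2\<close> by simp
      then have "y ^ (2 * t - 1) = y powr (2 * real t - 1)"
        using assms(3) by (simp add: of_nat_diff flip: powr_realpow)
      also have "\<dots> = (n / r) powr (1 / real t * (2 * real t - 1))"
        by (simp add: y_def powr_powr)
      also have "1 / real t * (2 * real t - 1) = 2 - 1 / real t"
        using assms(3) by (simp add: field_simps)
      finally show ?thesis .
    qed
    also have "\<dots> = n powr (2 - 1 / real t) / r powr (2 - 1 / real t)"
      using \<open>n > 0\<close> r by (simp add: powr_divide)
    finally have "n powr (2 - 1 / real t) / r powr (2 - 1 / real t) = y ^ (2 * t - 1)" by simp
    also have "\<dots> \<le> (2 * real q) ^ (2 * t - 1)"
      using q \<open>y \<ge> 2\<close> by (intro power_mono) auto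
    also have "\<dots> = 2 ^ (2 * t - 1) * real q ^ (2 * t - 1)"
      by (rule power_mult_distrib)
    finally have "n powr (2 - 1 / real t) / r powr (2 - 1 / real t) / 2 ^ (2 * t - 1) \<le> real q ^ (2 * t - 1)"
      by (subst pos_divide_le_eq) (simp_all add: mult.commute)
    then have "n powr (2 - 1 / real t) / (2 ^ (2 * t - 1) * r powr (2 - 1 / real t)) \<le> real q ^ (2 * t - 1)"
      by (simp add: mult.commute)
    then have "\<kappa> * (n powr (2 - 1 / real t) / (2 ^ (2 * t - 1) * r powr (2 - 1 / real t))) \<le> \<kappa> * real q ^ (2 * t - 1)"
      using assms(4) by (intro mult_left_mono) auto
    also note E(3)
    finally have "\<kappa> * (n powr (2 - 1 / real t) / (2 ^ (2 * t - 1) * r powr (2 - 1 / real t))) * (d * c * n)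
        \<le> real (card E) * (d * c * n)"
      using assms \<open>n > 0\<close> by (intro mult_right_mono) auto
    also note low
    also have "\<kappa> * (n powr (2 - 1 / real t) / (2 ^ (2 * t - 1) * r powr (2 - 1 / real t))) * (d * c * n)
        = C * (n powr (2 - 1 / real t) * n)"
      by (simp add: C_def)
    also have "n powr (2 - 1 / real t) * n = n powr (3 - 1 / real t)"
    proof -
      have "n powr (2 - 1 / real t) * n = n powr (2 - 1 / real t) * n powr 1"
        using \<open>n > 0\<close> by simp
      also have "\<dots> = n powr (3 - 1 / real t)"
        by (simp only: powr_add[symmetric]) simp
      finally show ?thesis .
    qed
    finally show ?case .
  qed
  with \<open>C > 0\<close> show thesis using that by blast
qed

lemma opx_bigtheta:
  assumes "d > 0" "c > 0" "t \<ge> 2" "\<kappa> > 0"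
    and "\<And>m q. m > 0 \<Longrightarrow> q = 2 ^ m \<Longrightarrow>
      \<exists>E. biclique_free 3 t E \<and> E \<subseteq> {..<q ^ t} \<times> {..<q ^ t} \<and> \<kappa> * real q ^ (2 * t - 1) \<le> real (card E)"
  shows "(\<lambda>n. opx n (Q (cross d) t c)) \<in> \<Theta>(\<lambda>n. n powr (3 - 1 / real t))"
proof -
  obtain C1 where C1: "C1 > 0" "eventually (\<lambda>n. C1 * n powr (3 - 1 / real t) \<le> opx n (Q (cross d) t c)) at_top"
    by (rule opx_lower_bound[of d c t \<kappa>]) (use assms in auto)
  obtain C2 where C2: "C2 > 0" "eventually (\<lambda>n. opx n (Q (cross d) t c) \<le> C2 * n powr (3 - 1 / real t)) at_top"
    using opx_upper_bound[OF assms(1-3)] by blast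
  from C1(2) C2(2) have "eventually (\<lambda>n. C1 * norm (n powr (3 - 1 / real t)) \<le> norm (opx n (Q (cross d) t c)) \<and>
      norm (opx n (Q (cross d) t c)) \<le> C2 * norm (n powr (3 - 1 / real t))) at_top"
  proof eventually_elim
    case (elim n)
    have "0 \<le> C1 * n powr (3 - 1 / real t)" using C1(1) by simp
    with elim show ?case by simp
  qed
  with C1(1) C2(1) show ?thesis by (rule bigthetaI')
qed

theorem corollary5p19:
  fixes d c :: real
  assumes "d > 0" and "c > 0"
  shows "(\<lambda>n. opx n (Q (cross d) 2 c)) \<in> \<Theta>(\<lambda>n. n powr (5/2))
       \<and> (\<lambda>n. opx n (Q (cross d) 3 c)) \<in> \<Theta>(\<lambda>n. n powr (8/3))"
proof
  have "(\<lambda>n. opx n (Q (cross d) 2 c)) \<in> \<Theta>(\<lambda>n. n powr (3 - 1 / real 2))"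
  proof (rule opx_bigtheta[OF assms, where \<kappa> = 1])
    fix m q :: nat assume "m > 0" "q = 2 ^ m"
    then obtain E where "biclique_free 3 2 E" "E \<subseteq> {..<q^2} \<times> {..<q^2}" "card E = q ^ 3"
      by (rule K22_free_graph)
    then show "\<exists>E. biclique_free 3 2 E \<and> E \<subseteq> {..<q ^ 2} \<times> {..<q ^ 2} \<and> 1 * real q ^ (2 * 2 - 1) \<le> real (card E)"
      by (intro exI[of _ E]) simp
  qed simp_all
  then show "(\<lambda>n. opx n (Q (cross d) 2 c)) \<in> \<Theta>(\<lambda>n. n powr (5/2))" by simp
  have "(\<lambda>n. opx n (Q (cross d) 3 c)) \<in> \<Theta>(\<lambda>n. n powr (3 - 1 / real 3))"
  \<comment> \<open>The norm graph has at least q^5 / 4 edges on q^3 labels per side, and 5 is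
    \<open>2 * t - 1\<close> for \<open>t = 3\<close>.\<close>
  proof (rule opx_bigtheta[OF assms, where \<kappa> = "1 / 4"])
    fix m q :: nat assume "m > 0" "q = 2 ^ m"
    then obtain E where E: "biclique_free 3 3 E" "E \<subseteq> {..<q^3} \<times> {..<q^3}" "4 * card E \<ge> q ^ 5"
      by (rule K33_free_graph)
    from E(3) have "real (q ^ 5) \<le> real (4 * card E)"
      by (simp only: of_nat_le_iff)
    with E(1,2) show "\<exists>E. biclique_free 3 3 E \<and> E \<subseteq> {..<q ^ 3} \<times> {..<q ^ 3} \<and> 1 / 4 * real q ^ (2 * 3 - 1) \<le> real (card E)"
      by (intro exI[of _ E]) simp
  qed simp_all
  then show "(\<lambda>n. opx n (Q (cross d) 3 c)) \<in> \<Theta>(\<lambda>n. n powr (8/3))" by simp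
qed

end
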